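(* Let $P\subset\mathbb{R}^n$ be a full-dimensional polytope that is isotropic and a local maximizer of the isotropic constant $K\mapsto L_K$ on full-dimensional convex bodies in $\mathbb{R}^n$. Let $\pi_{\mathsf{W}}$ denote the metric projection onto the closed convex cone $\mathsf{W}^2(P)$ in the Hilbert space $L^2(\mathrm{bd}\,P,\mathrm{vol}_\Phi)$. Then $$\pi_{\mathsf{W}}\big(x\mapsto\|x\|_2^2-n-2\big)=0\in L^2(\mathrm{bd}\,P,\mathrm{vol}_\Phi).$$ Moreover, if $F\subset P$ is a facet and $X$ is a random vector uniformly distributed on $F$, then $$\mathbb{E}\big[\|X\|_2^2\,X\big]=(n+2)\,\mathbb{E}[X].$$
   Context: A convex body is a non-empty compact convex subset of $\mathbb{R}^n$; the space of (full-dimensional) convex bodies carries the topology of the Hausdorff metric, and "local maximizer" refers to this topology. The isotropic constant $L_K>0$ of a full-dimensional convex body $K$ is given by $$L_K^{2n}=\frac{\det\left[\int_{K-c_K}x_ix_j\,dx\right]_{i,j}}{\mathrm{vol}(K)^{n+2}},\qquad c_K=\frac1{\mathrm{vol}(K)}\int_Kx\,dx.$$ $K$ is isotropic if $c_K=0$ and $\frac1{\mathrm{vol}(K)}\int_Kx_ix_j\,dx=\delta_{ij}$ for all $i,j$. A polytope is the convex hull of a finite set; $\Phi(P)$ is the set of proper (non-empty) faces of $P$. A signed measure is a finite signed Borel measure on $\mathbb{R}^n$; $\mathsf{M}(X)$ is the space of signed measures supported on the Borel set $X$, i.e. vanishing on all Borel subsets of $\mathbb{R}^n\setminus X$. A family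 $(K_t)_{t\in[0,1]}$ of full-dimensional convex bodies is weakly differentiable if for every $f\in C(\mathbb{R}^n)$ the function $\phi_f(t)=\int_{K_t}f(x)\,dx$ is differentiable from the right at $t=0$; its weak derivative is $K_0'(f)=\frac{d}{dt}\phi_f(t)|_{t=0}$. $\mu\in\mathsf{M}(\mathrm{bd}\,K)$ is a small perturbation of $K$ if there is a weakly differentiable family with $K_0=K$ and $K_0'(f)=\int_{\mathrm{bd}\,K}f\,d\mu$ for all $f\in C(\mathbb{R}^n)$; $\mathsf{W}(K)$ is the set of small perturbations of $K$. For $F\in\Phi(P)$, $\mathrm{vol}_F$ is the restriction to $F$ of the Lebesgue measure on the affine hull of $F$ (unit point mass if $F$ is a vertex), and $\mathrm{vol}_\Phi=\sum_{F\in\Phi(P)}\mathrm{vol}_F$. Finally, $$\mathsf{W}^2(P)=\{f\in L^2(\mathrm{bd}\,P,\mathrm{vol}_\Phi)\mid\text{there is }\mu\in\mathsf{W}(P)\text{ with } d\mu=f\,d\mathrm{vol}_\Phi\},$$ which is a closed convex cone in $L^2(\mathrm{bd}\,P,\mathrm{vol}_\Phi)$. *)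

theory Defs
  imports "HOL-Probability.Probability"
begin

definition convex_body :: "(real ^ 'n) set \<Rightarrow> bool" where
  "convex_body K \<longleftrightarrow> K \<noteq> {} \<and> compact K \<and> convex K"

definition full_dim_convex_body :: "(real ^ 'n) set \<Rightarrow> bool" where
  "full_dim_convex_body K \<longleftrightarrow> convex_body K \<and> aff_dim K = int CARD('n)"

definition hausdorff_distance :: "'a::metric_space set \<Rightarrow> 'a set \<Rightarrow> real" where
  "hausdorff_distance K L = max (SUP x\<in>K. infdist x L) (SUP y\<in>L. infdist y K)"

abbreviation vol :: "(real ^ 'n) set \<Rightarrow> real" where
  "vol K \<equiv> measure lborel K"

definition centroid :: "(real ^ 'n) set \<Rightarrow> real ^ 'n" where
  "centroid K = (1 / vol K) *\<^sub>R (LINT x:K|lborel. x)"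

definition moment_matrix :: "(real ^ 'n) set \<Rightarrow> real ^ 'n ^ 'n" where
  "moment_matrix K = (\<chi> i j. LINT x:K|lborel. x $ i * x $ j)"

text \<open>For a full-dimensional convex body the radicand is positive, so the root below is
  the unique positive number whose power of order \<open>2n\<close> is the radicand.\<close>

definition isotropic_constant :: "(real ^ 'n) set \<Rightarrow> real" where
  "isotropic_constant K =
     root (2 * CARD('n))
       (det (moment_matrix ((\<lambda>x. x - centroid K) ` K)) / vol K ^ (CARD('n) + 2))"

text \<open>The volume of an isotropic body is not normalised; its covariance matrix is the identity.\<close>

definition isotropic :: "(real ^ 'n) set \<Rightarrow> bool" where
  "isotropic K \<longleftrightarrow> centroid K = 0 \<and> (1 / vol K) *\<^sub>R moment_matrix K = mat 1"

definition isotropic_constant_local_maximizer :: "(real ^ 'n) set \<Rightarrow> bool" where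
  "isotropic_constant_local_maximizer K \<longleftrightarrow>
     full_dim_convex_body K \<and>
     (\<exists>\<epsilon>>0. \<forall>L. full_dim_convex_body L \<and> hausdorff_distance K L < \<epsilon> \<longrightarrow>
        isotropic_constant L \<le> isotropic_constant K)"

text \<open>A finite signed Borel measure is a real-valued set function, of which only the values on
  Borel sets matter. Countable additivity forces the value 0 on the empty set.\<close>

definition signed_measure :: "('a::topological_space set \<Rightarrow> real) \<Rightarrow> bool" where
  "signed_measure \<mu> \<longleftrightarrow>
     (\<forall>A :: nat \<Rightarrow> 'a set. range A \<subseteq> sets borel \<and> disjoint_family A \<longrightarrow>
        (\<lambda>i. \<mu> (A i)) sums \<mu> (\<Union>i. A i))"

definition signed_measures_on :: "'a::topological_space set \<Rightarrow> ('a set \<Rightarrow> real) set" where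
  "signed_measures_on X =
     {\<mu>. signed_measure \<mu> \<and> (\<forall>A\<in>sets borel. A \<subseteq> - X \<longrightarrow> \<mu> A = 0)}"

text \<open>The positive part of the Jordan decomposition; the negative part of \<open>\<mu>\<close> is the positive
  part of \<open>-\<mu>\<close>. Sets with \<open>\<mu> B < 0\<close> contribute \<open>ennreal (\<mu> B) = 0\<close>, which is already
  attained at the empty set.\<close>

definition positive_part :: "('a::topological_space set \<Rightarrow> real) \<Rightarrow> 'a measure" where
  "positive_part \<mu> =
     measure_of UNIV (sets borel) (\<lambda>A. SUP B\<in>{B \<in> sets borel. B \<subseteq> A}. ennreal (\<mu> B))"

definition signed_integral ::
  "('a::topological_space set \<Rightarrow> real) \<Rightarrow> 'a set \<Rightarrow> ('a \<Rightarrow> real) \<Rightarrow> real" where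
  "signed_integral \<mu> X f =
     (LINT x:X|positive_part \<mu>. f x) - (LINT x:X|positive_part (\<lambda>A. - \<mu> A). f x)"

text \<open>A family indexed by the unit interval is a function on the reals of which only the
  restriction to \<open>{0..1}\<close> matters.\<close>

definition weakly_differentiable :: "(real \<Rightarrow> (real ^ 'n) set) \<Rightarrow> bool" where
  "weakly_differentiable K \<longleftrightarrow>
     (\<forall>t\<in>{0..1}. full_dim_convex_body (K t)) \<and>
     (\<forall>f :: real ^ 'n \<Rightarrow> real. continuous_on UNIV f \<longrightarrow>
        (\<lambda>t. LINT x:K t|lborel. f x) differentiable (at 0 within {0..1}))"

definition weak_derivative ::
  "(real \<Rightarrow> (real ^ 'n) set) \<Rightarrow> (real ^ 'n \<Rightarrow> real) \<Rightarrow> real" where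
  "weak_derivative K f =
     vector_derivative (\<lambda>t. LINT x:K t|lborel. f x) (at 0 within {0..1})"

definition small_perturbations :: "(real ^ 'n) set \<Rightarrow> ((real ^ 'n) set \<Rightarrow> real) set" where
  "small_perturbations K =
     {\<mu> \<in> signed_measures_on (frontier K).
        \<exists>F. weakly_differentiable F \<and> F 0 = K \<and>
          (\<forall>f. continuous_on UNIV f \<longrightarrow>
             weak_derivative F f = signed_integral \<mu> (frontier K) f)}"

definition proper_faces :: "'a::euclidean_space set \<Rightarrow> 'a set set" where
  "proper_faces P = {F. F face_of P \<and> F \<noteq> {} \<and> F \<noteq> P}"

definition orthonormal_frame :: "'a::euclidean_space set \<Rightarrow> 'a \<times> 'a set \<Rightarrow> bool" where
  "orthonormal_frame A = (\<lambda>(p, B).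
     p \<in> A \<and> pairwise orthogonal B \<and> (\<forall>b\<in>B. norm b = 1) \<and> span B = (\<lambda>x. x - p) ` A)"

text \<open>Lebesgue measure on a non-empty affine subspace \<open>A\<close>, as a Borel measure on the ambient
  space: the image of the product Lebesgue measure under orthonormal affine coordinates (compare
  the definition of \<open>lborel\<close>). It does not depend on the chosen frame. If \<open>A\<close> is a single
  point, then the basis is empty and this is the unit point mass.\<close>

definition affine_lborel :: "'a::euclidean_space set \<Rightarrow> 'a measure" where
  "affine_lborel A =
     (let (p, B) = (SOME pB. orthonormal_frame A pB)
      in distr (\<Pi>\<^sub>M b\<in>B. lborel) borel (\<lambda>y. p + (\<Sum>b\<in>B. y b *\<^sub>R b)))"

definition vol_face :: "'a::euclidean_space set \<Rightarrow> 'a measure" where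
  "vol_face F = density (affine_lborel (affine hull F)) (indicator F)"

definition vol_faces :: "'a::euclidean_space set \<Rightarrow> 'a measure" where
  "vol_faces P =
     measure_of UNIV (sets borel) (\<lambda>A. \<Sum>F\<in>proper_faces P. emeasure (vol_face F) A)"

definition square_integrable :: "'a measure \<Rightarrow> ('a \<Rightarrow> real) \<Rightarrow> bool" where
  "square_integrable M f \<longleftrightarrow> f \<in> borel_measurable M \<and> integrable M (\<lambda>x. (f x)\<^sup>2)"

definition ae_class :: "'a measure \<Rightarrow> ('a \<Rightarrow> real) \<Rightarrow> ('a \<Rightarrow> real) set" where
  "ae_class M f = {g \<in> borel_measurable M. AE x in M. g x = f x}"

definition L2 :: "'a measure \<Rightarrow> ('a \<Rightarrow> real) set set" where
  "L2 M = {ae_class M f | f. square_integrable M f}"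

definition L2_dist :: "'a measure \<Rightarrow> ('a \<Rightarrow> real) set \<Rightarrow> ('a \<Rightarrow> real) set \<Rightarrow> real" where
  "L2_dist M u v = sqrt (LINT x|M. ((SOME f. f \<in> u) x - (SOME g. g \<in> v) x)\<^sup>2)"

text \<open>The nearest point in \<open>C\<close>, which exists uniquely if \<open>C\<close> is closed, convex and non-empty.\<close>

definition metric_projection ::
  "'a measure \<Rightarrow> ('a \<Rightarrow> real) set set \<Rightarrow> ('a \<Rightarrow> real) set \<Rightarrow> ('a \<Rightarrow> real) set" where
  "metric_projection M C u =
     (THE v. v \<in> C \<and> (\<forall>w\<in>C. L2_dist M u v \<le> L2_dist M u w))"

text \<open>The measure \<open>vol_faces P\<close> lives on all of space but is carried by \<open>frontier P\<close>, so that its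
  \<open>L2\<close> is the space of square-integrable functions on the boundary of \<open>P\<close>.\<close>

definition W2 :: "(real ^ 'n) set \<Rightarrow> (real ^ 'n \<Rightarrow> real) set set" where
  "W2 P =
     {u \<in> L2 (vol_faces P). \<exists>f\<in>u. \<exists>\<mu>\<in>small_perturbations P.
        \<forall>A\<in>sets borel. \<mu> A = (LINT x:A|vol_faces P. f x)}"

end

theory Submission
  imports Defs
begin

text \<open>
  Write \<open>n\<close> for the dimension and \<open>g x = (norm x)\<^sup>2 - n - 2\<close>. Both claims express that the first variation of
  the isotropic constant at a local maximizer is nonpositive.

  Let \<open>K t\<close> be a family of bodies starting at \<open>P\<close> for which the integral of every continuous \<open>f\<close> over \<open>K t\<close>
  has a right derivative \<open>\<Lambda> f\<close> at 0. Such a family converges to \<open>P\<close> in the Hausdorff metric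
  (\<open>weak_convergence_imp_hausdorff\<close>), so \<open>P\<close> beats its members for small \<open>t\<close>. At an isotropic body the
  derivative of the \<open>2n\<close>-th power of the isotropic constant is a positive multiple of \<open>\<Lambda> g\<close>, because the
  covariance matrix is the identity (derivative of the determinant: trace) and the centroid enters only to second
  order. Hence \<open>\<Lambda> g \<le> 0\<close> (\<open>local_maximizer_first_order\<close>).

  If \<open>f\<close> is the density of a small perturbation of \<open>P\<close> with respect to the measure on the faces, then \<open>\<Lambda> g\<close> is the inner product of
  \<open>f\<close> and \<open>g\<close>. So \<open>g\<close> lies in the polar of the set \<open>W2 P\<close>, which contains 0, and by expanding the
  square 0 is the unique nearest point to \<open>g\<close> (\<open>metric_projection_eq_zero\<close>).

  For the facet identity, move a single facet \<open>F\<close>: write \<open>P\<close> as a larger body cut by the supporting half-space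
  of \<open>F\<close> (\<open>facet_constraint_removal\<close>) and tilt that half-space so that \<open>F\<close> moves with an affine normal
  speed \<open>l\<close>. The derivative \<open>\<Lambda> f\<close> is then the integral of \<open>l * f\<close> over \<open>F\<close>
  (\<open>facet_variation_derivative\<close>), so the integral of \<open>l * g\<close> over \<open>F\<close> is nonpositive for \<open>l\<close> and for \<open>-l\<close>, and
  thus vanishes. Letting \<open>l\<close> run through the coordinate functions gives the claim.
\<close>

section \<open>Weak convergence of convex bodies implies Hausdorff convergence\<close>

lemma full_dim_convex_bodyD:
  fixes K :: "(real ^ 'n) set"
  assumes "full_dim_convex_body K"
  shows "compact K" "convex K" "interior K \<noteq> {}"
proof -
  show K: "compact K" "convex K"
    using assms by (auto simp: full_dim_convex_body_def convex_body_def)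
  have "aff_dim K = int DIM(real^'n)"
    using assms by (simp add: full_dim_convex_body_def)
  then show "interior K \<noteq> {}"
    using K(2) assms aff_dim_eq_full[of K] rel_interior_interior[of K] rel_interior_eq_empty[OF K(2)]
    by (auto simp: convex_body_def full_dim_convex_body_def)
qed

lemma set_integrable_compact_continuous:
  fixes f :: "'a::euclidean_space \<Rightarrow> 'b::{banach, second_countable_topology}"
  assumes "compact K" "continuous_on UNIV f"
  shows "set_integrable lborel K f"
  unfolding set_integrable_def
  using assms borel_integrable_compact continuous_on_subset by blast

lemma set_integral_pos_of_open_subset:
  fixes f :: "'a::euclidean_space \<Rightarrow> real"
  assumes "set_integrable lborel K f" "\<And>x. f x \<ge> 0" "open U" "U \<noteq> {}" "U \<subseteq> K" "\<And>x. x \<in> U \<Longrightarrow> f x > 0"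
  shows "(LINT x:K|lborel. f x) > 0"
proof (rule ccontr)
  assume "\<not> ?thesis"
  moreover have "(LINT x:K|lborel. f x) \<ge> 0"
    unfolding set_lebesgue_integral_def using assms(2) by (intro integral_nonneg_AE) simp
  ultimately have "(LINT x|lborel. indicator K x *\<^sub>R f x) = 0"
    unfolding set_lebesgue_integral_def by simp
  then have "AE x in lborel. indicator K x *\<^sub>R f x = 0"
    using integral_nonneg_eq_0_iff_AE[of lborel "\<lambda>x. indicator K x *\<^sub>R f x"] assms(1,2)
    by (simp add: set_integrable_def)
  then have "AE x in lborel. x \<notin> U"
    by (rule AE_mp) (use assms(5,6) in \<open>fastforce intro!: AE_I2 simp: indicator_def\<close>)
  then have "U \<in> null_sets lborel"
    using assms(3) by (subst AE_iff_null_sets) (auto simp: borel_open)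
  then show False
    using open_not_negligible[OF assms(3,4)] null_sets_completionI
    by (auto simp: negligible_iff_null_sets)
qed

text \<open>Half of Hausdorff convergence: a bump function supported near a point of \<open>P\<close> has positive
  integral over \<open>P\<close>, hence eventually over \<open>K t\<close>, so \<open>K t\<close> meets its support. By compactness finitely
  many bumps serve all points of \<open>P\<close>.\<close>

lemma eventually_body_meets_balls:
  fixes P :: "'a::euclidean_space set"
  assumes P: "compact P" "convex P" "interior P \<noteq> {}"
    and lim: "\<And>f :: 'a \<Rightarrow> real. continuous_on UNIV f \<Longrightarrow>
      ((\<lambda>t. LINT x:K t|lborel. f x) \<longlongrightarrow> (LINT x:P|lborel. f x)) \<Phi>"
    and e: "e > 0"
  shows "\<forall>\<^sub>F t in \<Phi>. \<forall>p\<in>P. infdist p (K t) < e"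
proof -
  have "\<exists>C. finite C \<and> C \<subseteq> P \<and> P \<subseteq> (\<Union>c\<in>C. ball c (e/2))"
    by (rule compactE_image[OF P(1), of P "\<lambda>c. ball c (e/2)"]) (use e in \<open>auto intro!: exI\<close>)
  then obtain C where C: "finite C" "C \<subseteq> P" "P \<subseteq> (\<Union>c\<in>C. ball c (e/2))" by blast
  have "\<forall>\<^sub>F t in \<Phi>. K t \<inter> ball c (e/2) \<noteq> {}" if "c \<in> C" for c
  proof -
    define f where "f x = max 0 (e/2 - dist c x)" for x
    have f: "continuous_on UNIV f"
      unfolding f_def by (intro continuous_intros)
    have "c \<in> closure (interior P)"
      using that C(2) convex_closure_interior[OF P(2,3)] closure_subset by blast
    then have ne: "interior P \<inter> ball c (e/2) \<noteq> {}"
      using e unfolding closure_approachable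
      by (metis Int_iff dist_commute empty_iff half_gt_zero mem_ball)
    have "(LINT x:P|lborel. f x) > 0"
      by (rule set_integral_pos_of_open_subset[OF set_integrable_compact_continuous[OF P(1) f] _ _ ne])
        (use interior_subset in \<open>auto simp: f_def\<close>)
    then have "\<forall>\<^sub>F t in \<Phi>. (LINT x:K t|lborel. f x) > 0"
      using order_tendstoD(1)[OF lim[OF f]] by blast
    then show ?thesis
    proof (rule eventually_mono)
      fix t assume pos: "(LINT x:K t|lborel. f x) > 0"
      show "K t \<inter> ball c (e/2) \<noteq> {}"
      proof
        assume "K t \<inter> ball c (e/2) = {}"
        then have "(\<lambda>x. indicator (K t) x *\<^sub>R f x) = (\<lambda>x. 0)"
          by (fastforce simp: f_def indicator_def max_def disjoint_iff)
        then show False using pos by (simp add: set_lebesgue_integral_def)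
      qed
    qed
  qed
  then have "\<forall>\<^sub>F t in \<Phi>. \<forall>c\<in>C. K t \<inter> ball c (e/2) \<noteq> {}"
    using C(1) by (simp add: eventually_ball_finite)
  then show ?thesis
  proof (rule eventually_mono, intro ballI)
    fix t p assume t: "\<forall>c\<in>C. K t \<inter> ball c (e/2) \<noteq> {}" and "p \<in> P"
    then obtain c where c: "c \<in> C" "dist c p < e/2" using C(3) by auto
    with t obtain k where k: "k \<in> K t" "dist c k < e/2" by fastforce
    have "infdist p (K t) \<le> dist p k" by (rule infdist_le[OF k(1)])
    also have "\<dots> < e" using c(2) k(2) dist_triangle3[of p k c] by linarith
    finally show "infdist p (K t) < e" .
  qed
qed

text \<open>If a point \<open>z\<close> near the centre were missing from \<open>K\<close>, a hyperplane would separate it from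
  \<open>K\<close>. Moving from \<open>z\<close> by \<open>r/2\<close> away from that hyperplane stays inside the large ball and ends at
  distance at least \<open>r/2\<close> from \<open>K\<close>.\<close>

lemma convex_contains_half_ball:
  fixes K :: "'a::euclidean_space set"
  assumes K: "convex K" "closed K" "K \<noteq> {}" and r: "r > 0"
    and near: "\<And>p. p \<in> ball b r \<Longrightarrow> infdist p K < r/2"
  shows "ball b (r/2) \<subseteq> K"
proof
  fix z assume z: "z \<in> ball b (r/2)"
  show "z \<in> K"
  proof (rule ccontr)
    assume "z \<notin> K"
    then obtain a d where ad: "a \<bullet> z < d" "\<forall>x\<in>K. a \<bullet> x > d"
      using separating_hyperplane_closed_point[OF K(1,2)] by blast
    have a0: "a \<noteq> 0" using ad K(3) by force
    define u where "u = a /\<^sub>R norm a"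
    have u: "norm u = 1" "u \<bullet> u = 1" using a0
      by (auto simp: u_def dot_square_norm power2_eq_square)
    (* After a step of length r / 2 along the normal, the half-space containing K is further than r / 2. *)
    define p where "p = z - (r/2) *\<^sub>R u"
    have "dist b p \<le> dist b z + dist z p" by (rule dist_triangle)
    moreover have "dist z p = r/2" using u r by (simp add: p_def dist_norm)
    ultimately have "p \<in> ball b r" using z by (simp add: dist_commute)
    then have lt: "infdist p K < r/2" by (rule near)
    obtain x where x: "x \<in> K" "infdist p K = dist p x"
      using infdist_attains_inf[OF K(2,3)] by metis
    have "0 < (a \<bullet> x - a \<bullet> z) / norm a" using ad x(1) a0 by force
    then have "0 < u \<bullet> (x - z)"
      by (simp add: u_def inner_diff_right divide_inverse algebra_simps)
    then have "r/2 < u \<bullet> (x - p)"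
      using u by (simp add: p_def inner_diff_right inner_add_right algebra_simps)
    also have "\<dots> \<le> norm (x - p)" using norm_cauchy_schwarz[of u "x - p"] u by simp
    finally show False using lt x(2) by (simp add: dist_norm norm_minus_commute)
  qed
qed

text \<open>The other half, where convexity matters. Test the weak convergence with the distance to
  \<open>P\<close>: its integral over \<open>K t\<close> tends to 0. But \<open>K t\<close> contains a fixed ball inside \<open>P\<close>, so a point of
  \<open>K t\<close> far from \<open>P\<close> would span with that ball a piece of definite volume at definite distance
  from \<open>P\<close>.\<close>

lemma eventually_body_within:
  fixes P :: "'a::euclidean_space set"
  assumes P: "compact P" "convex P" "interior P \<noteq> {}"
    and K: "\<forall>\<^sub>F t in \<Phi>. compact (K t) \<and> convex (K t) \<and> K t \<noteq> {}"
    and lim: "\<And>f :: 'a \<Rightarrow> real. continuous_on UNIV f \<Longrightarrow>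
      ((\<lambda>t. LINT x:K t|lborel. f x) \<longlongrightarrow> (LINT x:P|lborel. f x)) \<Phi>"
    and e: "e > 0"
  shows "\<forall>\<^sub>F t in \<Phi>. \<forall>x\<in>K t. infdist x P < e"
proof -
  obtain b r0 where "r0 > 0" "ball b r0 \<subseteq> P"
    using P(3) by (metis all_not_in_conv mem_interior)
  define r where "r = r0 / 2"
  have r: "r > 0" "ball b (2 * r) \<subseteq> P" using \<open>r0 > 0\<close> \<open>ball b r0 \<subseteq> P\<close> by (auto simp: r_def)
  have bP: "b \<in> P" using r by auto
  obtain R where R: "R > 0" "P \<subseteq> cball b R"
    using bounded_subset_ballD[OF compact_imp_bounded[OF P(1)], of b] ball_subset_cball by blast
  (* The point y chosen below has distance at most e + R from b, so this contraction ratio moves the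
     ball towards y by at most e / 2. *)
  define s where "s = e / (2 * (r + e + R))"
  have s: "s > 0" "s < 1" "s * (r + e + R) = e / 2"
    using e r R by (auto simp: s_def field_simps)
  define d where "d x = infdist x P" for x
  have d: "continuous_on UNIV d" unfolding d_def by (intro continuous_intros)
  have "(LINT x:P|lborel. d x) = 0"
    unfolding set_lebesgue_integral_def
    by (intro integral_eq_zero_AE AE_I2) (auto simp: d_def indicator_def)
  moreover have v: "measure lborel (ball 0 (s * r) :: 'a set) > 0"
    using s r by (simp add: content_ball_pos)
  ultimately have "\<forall>\<^sub>F t in \<Phi>. (LINT x:K t|lborel. d x) < e/2 * measure lborel (ball 0 (s * r) :: 'a set)"
    using order_tendstoD(2)[OF lim[OF d], of "e/2 * measure lborel (ball 0 (s * r) :: 'a set)"] e by simp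
  moreover have "\<forall>\<^sub>F t in \<Phi>. \<forall>p\<in>P. infdist p (K t) < r"
    by (rule eventually_body_meets_balls[OF P lim r(1)])
  ultimately show ?thesis using K
  proof eventually_elim
    case (elim t)
    have rK: "ball b r \<subseteq> K t"
      using convex_contains_half_ball[of "K t" "2*r" b] elim r compact_imp_closed[of "K t"]
      by (auto simp: subset_eq)
    have bK: "b \<in> K t" using rK r(1) centre_in_ball by blast
    show ?case
    proof (rule ccontr)
      assume "\<not> ?case"
      then obtain x where x: "x \<in> K t" "d x \<ge> e" by (auto simp: d_def not_less)
      (* Replace the far point by one at distance exactly e, which lies in a fixed bounded region. *)
      have "\<exists>\<theta>\<ge>0. \<theta> \<le> 1 \<and> d (b + \<theta> *\<^sub>R (x - b)) = e"
        by (rule IVT') (use x bP e d in \<open>auto simp: d_def intro!: continuous_intros\<close>)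
      then obtain \<theta> where \<theta>: "0 \<le> \<theta>" "\<theta> \<le> 1" "d (b + \<theta> *\<^sub>R (x - b)) = e" by blast
      define y where "y = b + \<theta> *\<^sub>R (x - b)"
      have "(1 - \<theta>) *\<^sub>R b + \<theta> *\<^sub>R x \<in> K t"
        using elim \<theta> x(1) bK by (intro convexD_alt) auto
      then have yK: "y \<in> K t" by (simp add: y_def algebra_simps)
      have dy: "infdist y P = e" using \<theta> by (simp add: y_def d_def)
      obtain q where q: "q \<in> P" "infdist y P = dist y q"
        using infdist_attains_inf[of P y] P(1) compact_imp_closed bP by blast
      have yb: "dist y b \<le> e + R"
        using q dy R dist_triangle[of y b q] by (force simp: dist_commute)
      define c where "c = (1 - s) *\<^sub>R y + s *\<^sub>R b"
      have ball: "w \<in> K t \<and> d w \<ge> e/2" if "w \<in> ball c (s * r)" for w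
      proof -
        define z where "z = b + (w - c) /\<^sub>R s"
        have z: "z \<in> ball b r"
          using that s by (simp add: z_def dist_norm norm_minus_commute divide_simps mult.commute)
        have w: "w = (1 - s) *\<^sub>R y + s *\<^sub>R z"
          using s by (simp add: z_def c_def algebra_simps)
        have 1: "w \<in> K t"
          unfolding w using elim yK z rK s by (intro convexD_alt) auto
        have "y - w = s *\<^sub>R (y - z)" unfolding w by (simp add: algebra_simps)
        then have "dist y w = s * dist y z" using s by (simp add: dist_norm)
        also have "\<dots> \<le> s * (r + e + R)"
          using s yb z dist_triangle[of y z b] by (intro mult_left_mono) auto
        finally have "dist y w \<le> e/2" using s by simp
        then show ?thesis
          using 1 dy infdist_triangle[of y P w] by (simp add: d_def)
      qed
      have fin: "emeasure lborel (ball c (s * r)) \<noteq> \<infinity>"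
        using emeasure_bounded_finite[OF bounded_ball, of c "s * r"] by (simp add: less_top[symmetric])
      have "e/2 * measure lborel (ball 0 (s * r) :: 'a set) = e/2 * measure lborel (ball c (s * r))"
        using s r by (simp add: content_ball)
      also have "\<dots> = (LINT x:ball c (s * r)|lborel. e/2)"
        by (simp add: set_lebesgue_integral_def)
      also have "\<dots> \<le> (LINT x:K t|lborel. d x)"
        unfolding set_lebesgue_integral_def
      proof (rule integral_mono)
        show "integrable lborel (\<lambda>x. indicat_real (ball c (s * r)) x *\<^sub>R (e / 2))"
          using fin by (intro integrable_scaleR_left integrable_real_indicator) (auto simp: top.not_eq_extremum)
        show "integrable lborel (\<lambda>x. indicat_real (K t) x *\<^sub>R d x)"
          using set_integrable_compact_continuous[of "K t" d] elim d by (simp add: set_integrable_def)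
        show "indicat_real (ball c (s * r)) x *\<^sub>R (e / 2) \<le> indicat_real (K t) x *\<^sub>R d x" for x
          using ball[of x] by (auto simp: indicator_def d_def infdist_nonneg)
      qed
      finally show False using elim by simp
    qed
  qed
qed

text \<open>Local maximality is stated in the Hausdorff metric, whereas a perturbation is only
  weakly differentiable; for convex bodies weak convergence of the volume measures restricted to them is enough.\<close>

lemma weak_convergence_imp_hausdorff:
  fixes P :: "'a::euclidean_space set"
  assumes P: "compact P" "convex P" "interior P \<noteq> {}"
    and K: "\<forall>\<^sub>F t in \<Phi>. compact (K t) \<and> convex (K t) \<and> K t \<noteq> {}"
    and lim: "\<And>f :: 'a \<Rightarrow> real. continuous_on UNIV f \<Longrightarrow>
      ((\<lambda>t. LINT x:K t|lborel. f x) \<longlongrightarrow> (LINT x:P|lborel. f x)) \<Phi>"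
    and e: "e > 0"
  shows "\<forall>\<^sub>F t in \<Phi>. hausdorff_distance P (K t) < e"
proof -
  have "\<forall>\<^sub>F t in \<Phi>. \<forall>p\<in>P. infdist p (K t) < e/2"
    by (rule eventually_body_meets_balls[OF P lim]) (use e in auto)
  moreover have "\<forall>\<^sub>F t in \<Phi>. \<forall>x\<in>K t. infdist x P < e/2"
    by (rule eventually_body_within[OF P K lim]) (use e in auto)
  ultimately show ?thesis using K
  proof eventually_elim
    case (elim t)
    have "P \<noteq> {}" using P(3) by auto
    then have "(SUP x\<in>P. infdist x (K t)) \<le> e/2"
      using elim by (intro cSUP_least) (simp_all add: less_imp_le)
    moreover have "(SUP y\<in>K t. infdist y P) \<le> e/2"
      using elim by (intro cSUP_least) (simp_all add: less_imp_le)
    ultimately show ?case using e by (auto simp: hausdorff_distance_def)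
  qed
qed

section \<open>The first variation of the isotropic constant\<close>

text \<open>In the Leibniz formula every permutation other than the identity moves at least two
  indices, so its product has two factors vanishing at \<open>s\<close> and does not contribute to the derivative.\<close>

lemma det_has_derivative_at_scalar:
  fixes M :: "real \<Rightarrow> real ^ 'n ^ 'n"
  assumes d: "\<And>i j. ((\<lambda>t. M t $ i $ j) has_real_derivative M' i j) (at s within S)"
    and M: "\<And>i j. M s $ i $ j = (if i = j then v else 0)"
  shows "((\<lambda>t. det (M t)) has_real_derivative v ^ (CARD('n) - 1) * (\<Sum>i\<in>UNIV. M' i i)) (at s within S)"
proof -
  have prod: "((\<lambda>t. \<Prod>i\<in>UNIV. M t $ i $ p i) has_real_derivative
      (if p = id then v ^ (CARD('n) - 1) * (\<Sum>i\<in>UNIV. M' i i) else 0)) (at s within S)"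
    if p: "p permutes UNIV" for p
  proof -
    have "((\<lambda>t. \<Prod>i\<in>UNIV. M t $ i $ p i) has_derivative
       (\<lambda>y. \<Sum>i\<in>UNIV. M' i (p i) * y * (\<Prod>j\<in>UNIV - {i}. M s $ j $ p j))) (at s within S)"
      using d by (intro has_derivative_prod) (simp add: has_field_derivative_def)
    moreover have "(\<lambda>y. \<Sum>i\<in>UNIV. M' i (p i) * y * (\<Prod>j\<in>UNIV - {i}. M s $ j $ p j)) =
       (*) (if p = id then v ^ (CARD('n) - 1) * (\<Sum>i\<in>UNIV. M' i i) else 0)"
    proof (cases "p = id")
      case True
      then show ?thesis
        by (auto simp: fun_eq_iff M sum_distrib_left sum_distrib_right card_Diff_singleton algebra_simps)
    next
      case False
      have zero: "(\<Prod>j\<in>UNIV - {i}. M s $ j $ p j) = 0" for i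
      proof -
        (* If p moves k it also moves p k, so a moved index different from i exists. *)
        obtain k where k: "p k \<noteq> k" using False by (auto simp: fun_eq_iff)
        have "p (p k) \<noteq> p k" using k permutes_inj[OF p] by (metis injD)
        with k obtain j where "j \<noteq> i" "p j \<noteq> j" by (cases "k = i") auto
        then show ?thesis by (intro prod_zero bexI[of _ j]) (auto simp: M)
      qed
      show ?thesis by (simp only: zero False if_False) (simp add: fun_eq_iff)
    qed
    ultimately show ?thesis by (simp add: has_field_derivative_def)
  qed
  have "((\<lambda>t. \<Sum>p\<in>{p. p permutes (UNIV::'n set)}. of_int (sign p) * (\<Prod>i\<in>UNIV. M t $ i $ p i))
    has_real_derivative (\<Sum>p\<in>{p. p permutes (UNIV::'n set)}. of_int (sign p) *
      (if p = id then v ^ (CARD('n) - 1) * (\<Sum>i\<in>UNIV. M' i i) else 0))) (at s within S)"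
    using prod by (intro DERIV_sum DERIV_cmult) auto
  also have "(\<Sum>p\<in>{p. p permutes (UNIV::'n set)}. of_int (sign p) *
      (if p = id then v ^ (CARD('n) - 1) * (\<Sum>i\<in>UNIV. M' i i) else 0)) =
     v ^ (CARD('n) - 1) * (\<Sum>i\<in>UNIV. M' i i)"
    by (simp add: if_distrib[of "\<lambda>x. _ * x"] sum.delta' sum.delta finite_permutations permutes_id sign_id
        cong: if_cong)
  finally show ?thesis by (simp add: det_def)
qed

lemma set_lebesgue_integral_translation:
  fixes K :: "(real ^ 'n) set" and h :: "real ^ 'n \<Rightarrow> real"
  assumes "compact K" "continuous_on UNIV h"
  shows "(LINT x:(\<lambda>x. x - c) ` K|lborel. h x) = (LINT x:K|lborel. h (x - c))"
proof -
  have K: "compact ((\<lambda>x. x - c) ` K)"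
    using assms(1) by (intro compact_continuous_image continuous_intros) auto
  have [measurable]: "(\<lambda>x. x - c) ` K \<in> sets borel"
    using K by (simp add: borel_closed compact_imp_closed)
  have [measurable]: "h \<in> borel_measurable borel"
    using assms(2) by (rule borel_measurable_continuous_onI)
  have eq: "indicator ((\<lambda>x. x - c) ` K) (- c + x) = (indicator K x :: real)" for x
    by (auto simp: indicator_def image_iff)
  have "(LINT x:(\<lambda>x. x - c) ` K|lborel. h x) =
    (LINT x|distr lborel borel ((+) (- c)). indicator ((\<lambda>x. x - c) ` K) x *\<^sub>R h x)"
    by (simp only: lborel_distr_plus set_lebesgue_integral_def)
  also have "\<dots> = (LINT x|lborel. indicator ((\<lambda>x. x - c) ` K) (- c + x) *\<^sub>R h (- c + x))"
    by (subst integral_distr) auto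
  finally show ?thesis
    unfolding eq by (simp add: set_lebesgue_integral_def)
qed

lemma set_integral_component:
  fixes f :: "'a \<Rightarrow> real ^ 'n"
  assumes "set_integrable M K f"
  shows "(LINT x:K|M. f x) $ i = (LINT x:K|M. f x $ i)"
proof -
  have "integral\<^sup>L M (\<lambda>x. (indicator K x *\<^sub>R f x) \<bullet> axis i 1) = integral\<^sup>L M (\<lambda>x. indicator K x *\<^sub>R f x) \<bullet> axis i 1"
    using assms by (intro integral_inner_left) (simp add: set_integrable_def)
  then show ?thesis by (simp add: set_lebesgue_integral_def inner_axis)
qed

text \<open>The covariance formula, which expresses the radicand through integrals of fixed
  continuous functions over \<open>K\<close>; those are the quantities controlled by weak differentiability.\<close>

lemma centered_moment_matrix:
  fixes K :: "(real ^ 'n) set"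
  assumes K: "compact K" and v: "vol K \<noteq> 0"
  shows "moment_matrix ((\<lambda>x. x - centroid K) ` K) $ i $ j =
    (LINT x:K|lborel. x $ i * x $ j) - (LINT x:K|lborel. x $ i) * (LINT x:K|lborel. x $ j) / vol K"
proof -
  define c where "c = centroid K"
  have c: "c $ k = (LINT x:K|lborel. x $ k) / vol K" for k
    by (simp add: c_def centroid_def set_integral_component[OF set_integrable_compact_continuous[OF K]])
  note int = set_integrable_compact_continuous[OF K]
  have "moment_matrix ((\<lambda>x. x - c) ` K) $ i $ j = (LINT x:K|lborel. (x - c) $ i * (x - c) $ j)"
    unfolding moment_matrix_def
    by (simp, subst set_lebesgue_integral_translation[OF K]) (auto intro!: continuous_intros)
  also have "\<dots> = (LINT x:K|lborel. x $ i * x $ j - (c $ i * x $ j + c $ j * x $ i - c $ i * c $ j))"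
    by (simp add: algebra_simps)
  also have "\<dots> = (LINT x:K|lborel. x $ i * x $ j) - (LINT x:K|lborel. c $ i * x $ j + c $ j * x $ i - c $ i * c $ j)"
    by (intro set_integral_diff int continuous_intros)
  also have "(LINT x:K|lborel. c $ i * x $ j + c $ j * x $ i - c $ i * c $ j) =
      (LINT x:K|lborel. c $ i * x $ j + c $ j * x $ i) - (LINT x:K|lborel. c $ i * c $ j)"
    by (intro set_integral_diff int continuous_intros)
  also have "(LINT x:K|lborel. c $ i * x $ j + c $ j * x $ i) =
      (LINT x:K|lborel. c $ i * x $ j) + (LINT x:K|lborel. c $ j * x $ i)"
    by (intro set_integral_add int continuous_intros)
  also have "(LINT x:K|lborel. c $ i * c $ j) = vol K * (c $ i * c $ j)"
    by (simp add: set_lebesgue_integral_def)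
  finally show ?thesis
    unfolding c_def[symmetric] using v by (simp add: c field_simps)
qed

lemma vol_full_dim_pos:
  fixes K :: "(real ^ 'n) set"
  assumes "full_dim_convex_body K"
  shows "vol K > 0"
proof -
  note K = full_dim_convex_bodyD[OF assms]
  have "(LINT x:K|lborel. 1::real) > 0"
    by (rule set_integral_pos_of_open_subset[OF set_integrable_compact_continuous[OF K(1)] _ open_interior K(3) interior_subset]) auto
  then show ?thesis by (simp add: set_lebesgue_integral_def)
qed

text \<open>The radicand of the isotropic constant is \<open>det (M t) / V t ^ (n + 2)\<close> with
  \<open>M\<close> built from the moments up to order two. At an isotropic \<open>P\<close> of volume \<open>v\<close> the matrix is \<open>v\<close> times
  the identity and the first moments vanish, so the centroid correction is of second order. The derivative
  is therefore \<open>v powi -3\<close> times the derivative of the integral of \<open>(norm x)\<^sup>2 - n - 2\<close>, and it cannot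
  be positive at a local maximum.\<close>

lemma local_maximizer_first_order:
  fixes P :: "(real ^ 'n) set" and K :: "real \<Rightarrow> (real ^ 'n) set"
  assumes iso: "isotropic P" and max: "isotropic_constant_local_maximizer P"
    and K0: "K 0 = P" and K: "\<forall>\<^sub>F t in at_right 0. full_dim_convex_body (K t)"
    and deriv: "\<And>f :: real ^ 'n \<Rightarrow> real. continuous_on UNIV f \<Longrightarrow>
      ((\<lambda>t. LINT x:K t|lborel. f x) has_real_derivative \<Lambda> f) (at_right 0)"
  shows "\<Lambda> (\<lambda>x. (norm x)\<^sup>2 - real CARD('n) - 2) \<le> 0"
proof -
  define n where "n = CARD('n)"
  have n: "n > 0" by (simp add: n_def)
  define E where "E f t = (LINT x:K t|lborel. f x)" for f :: "real ^ 'n \<Rightarrow> real" and t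
  define V where "V t = vol (K t)" for t
  define m1 where "m1 i t = E (\<lambda>x. x $ i) t" for i t
  define m2 where "m2 i j t = E (\<lambda>x. x $ i * x $ j) t" for i j t
  define M :: "real \<Rightarrow> real ^ 'n ^ 'n" where "M t = (\<chi> i j. m2 i j t - m1 i t * m1 j t / V t)" for t
  define R where "R t = det (M t) / V t ^ (n + 2)" for t
  obtain \<epsilon> where P: "full_dim_convex_body P" and \<epsilon>: "\<epsilon> > 0"
    "\<And>L. full_dim_convex_body L \<Longrightarrow> hausdorff_distance P L < \<epsilon> \<Longrightarrow> isotropic_constant L \<le> isotropic_constant P"
    using max by (auto simp: isotropic_constant_local_maximizer_def)
  note Pc = full_dim_convex_bodyD[OF P]
  define v where "v = vol P"
  have v: "v > 0" using vol_full_dim_pos[OF P] by (simp add: v_def)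
  have V1: "V t = E (\<lambda>x. 1) t" for t by (simp add: V_def E_def set_lebesgue_integral_def)
  have dE: "(E f has_real_derivative \<Lambda> f) (at_right 0)" if "continuous_on UNIV f" for f
    using deriv[OF that] by (simp add: E_def[abs_def])
  have dV: "(V has_real_derivative \<Lambda> (\<lambda>x. 1)) (at_right 0)"
    unfolding V1[abs_def] by (rule dE) (intro continuous_intros)
  have dm1: "(m1 i has_real_derivative \<Lambda> (\<lambda>x. x $ i)) (at_right 0)" for i
    unfolding m1_def[abs_def] by (rule dE) (intro continuous_intros)
  have dm2: "(m2 i j has_real_derivative \<Lambda> (\<lambda>x. x $ i * x $ j)) (at_right 0)" for i j
    unfolding m2_def[abs_def] by (rule dE) (intro continuous_intros)
  have V0: "V 0 = v" by (simp add: V_def v_def K0)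
  have m10: "m1 i 0 = 0" for i
  proof -
    have "centroid P $ i = 0" using iso by (simp add: isotropic_def)
    then show ?thesis using v
      by (simp add: centroid_def set_integral_component[OF set_integrable_compact_continuous[OF Pc(1)]] m1_def E_def K0 v_def)
  qed
  have m20: "m2 i j 0 = (if i = j then v else 0)" for i j
  proof -
    have "((1 / vol P) *\<^sub>R moment_matrix P) $ i $ j = mat 1 $ i $ j" using iso by (simp add: isotropic_def)
    then show ?thesis using v
      by (simp add: moment_matrix_def m2_def E_def K0 v_def mat_def split: if_splits)
  qed
  have dM: "((\<lambda>t. M t $ i $ j) has_real_derivative \<Lambda> (\<lambda>x. x $ i * x $ j)) (at_right 0)" for i j
    unfolding M_def using v
    by (auto intro!: derivative_eq_intros dm1 dm2 dV simp: m10 V0)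
  have M0: "M 0 $ i $ j = (if i = j then v else 0)" for i j
    by (simp add: M_def m10 m20)
  define S2 where "S2 = (\<Sum>i\<in>UNIV. \<Lambda> (\<lambda>x. x $ i * x $ i))"
  have ddet: "((\<lambda>t. det (M t)) has_real_derivative v ^ (n - 1) * S2) (at_right 0)"
    unfolding n_def S2_def by (rule det_has_derivative_at_scalar[OF dM M0])
  have det0: "det (M 0) = v ^ n"
    by (subst det_diagonal) (simp_all add: M0 n_def)
  have dR: "(R has_real_derivative (S2 - (n + 2) * \<Lambda> (\<lambda>x. 1)) / v ^ 3) (at_right 0)"
  proof -
    have "(R has_real_derivative
       (v ^ (n - 1) * S2 * v ^ (n + 2) - v ^ n * ((n + 2) * v ^ (n + 1) * \<Lambda> (\<lambda>x. 1))) / (v ^ (n + 2) * v ^ (n + 2))) (at_right 0)"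
      unfolding R_def
      by (rule derivative_eq_intros ddet dV refl | use v in \<open>force simp: V0 det0 algebra_simps\<close>)+
    also have "(v ^ (n - 1) * S2 * v ^ (n + 2) - v ^ n * ((n + 2) * v ^ (n + 1) * \<Lambda> (\<lambda>x. 1))) / (v ^ (n + 2) * v ^ (n + 2)) =
       (S2 - (n + 2) * \<Lambda> (\<lambda>x. 1)) / v ^ 3"
    proof -
      obtain k where k: "n = Suc k" using n by (cases n) auto
      show ?thesis using v unfolding k by (simp add: field_simps power2_eq_square power3_eq_cube)
    qed
    finally show ?thesis .
  qed
  have R: "isotropic_constant (K t) = root (2 * n) (R t)" if "full_dim_convex_body (K t)" for t
  proof -
    have "moment_matrix ((\<lambda>x. x - centroid (K t)) ` K t) = M t"
      using centered_moment_matrix[OF full_dim_convex_bodyD(1)[OF that]] vol_full_dim_pos[OF that]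
      by (simp add: vec_eq_iff M_def m1_def m2_def E_def V_def)
    then show ?thesis by (simp add: isotropic_constant_def R_def n_def V_def)
  qed
  have "\<forall>\<^sub>F t in at_right 0. hausdorff_distance P (K t) < \<epsilon>"
  proof (rule weak_convergence_imp_hausdorff[OF Pc])
    show "\<forall>\<^sub>F t in at_right 0. compact (K t) \<and> convex (K t) \<and> K t \<noteq> {}"
      using K by eventually_elim (auto simp: full_dim_convex_body_def convex_body_def)
    show "((\<lambda>t. LINT x:K t|lborel. f x) \<longlongrightarrow> (LINT x:P|lborel. f x)) (at_right 0)"
      if "continuous_on UNIV f" for f :: "real ^ 'n \<Rightarrow> real"
      using DERIV_continuous[OF deriv[OF that]] by (simp add: continuous_within K0)
  qed fact
  then have "\<forall>\<^sub>F t in at_right 0. (R t - R 0) / (t - 0) \<le> 0"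
    using K eventually_at_right_less[of 0]
  proof eventually_elim
    case (elim t)
    have "isotropic_constant (K t) \<le> isotropic_constant P" using \<epsilon> elim by blast
    then have "R t \<le> R 0" using R[of t] R[of 0] elim P K0 n by simp
    then show ?case using elim by (simp add: divide_nonpos_pos)
  qed
  then have "(S2 - (n + 2) * \<Lambda> (\<lambda>x. 1)) / v ^ 3 \<le> 0"
    using dR by (intro tendsto_upperbound[of "\<lambda>t. (R t - R 0) / (t - 0)" _ "at_right 0"])
      (auto simp: has_field_derivative_iff)
  then have le: "S2 - (n + 2) * \<Lambda> (\<lambda>x. 1) \<le> 0" using v by (simp add: divide_le_0_iff)
  let ?g = "\<lambda>x :: real ^ 'n. (norm x)\<^sup>2 - real CARD('n) - 2"
  have "E ?g t = (\<Sum>i\<in>UNIV. m2 i i t) - (n + 2) * V t" if "compact (K t)" for t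
  proof -
    note int = set_integrable_compact_continuous[OF that]
    have "E ?g t = (LINT x:K t|lborel. (\<Sum>i\<in>UNIV. x $ i * x $ i) - (n + 2) * 1)"
      by (simp add: E_def power2_norm_eq_inner inner_vec_def n_def algebra_simps)
    also have "\<dots> = (LINT x:K t|lborel. (\<Sum>i\<in>UNIV. x $ i * x $ i)) - (LINT x:K t|lborel. (n + 2) * 1)"
      by (intro set_integral_diff int continuous_intros)
    also have "(LINT x:K t|lborel. (\<Sum>i\<in>UNIV. x $ i * x $ i)) = (\<Sum>i\<in>UNIV. m2 i i t)"
      unfolding m2_def E_def set_lebesgue_integral_def scaleR_sum_right
      by (rule Bochner_Integration.integral_sum)
        (rule int[unfolded set_integrable_def], intro continuous_intros)
    also have "(LINT x:K t|lborel. (n + 2) * 1) = (n + 2) * V t"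
      by (simp add: V_def set_lebesgue_integral_def)
    finally show ?thesis .
  qed
  then have ev: "\<forall>\<^sub>F t in at_right 0. E ?g t = (\<Sum>i\<in>UNIV. m2 i i t) - (n + 2) * V t" and
     e0: "E ?g 0 = (\<Sum>i\<in>UNIV. m2 i i 0) - (n + 2) * V 0"
    using K full_dim_convex_bodyD(1) Pc(1) K0 by (auto elim!: eventually_mono)
  have "((\<lambda>t. (\<Sum>i\<in>UNIV. m2 i i t) - (n + 2) * V t) has_real_derivative S2 - (n + 2) * \<Lambda> (\<lambda>x. 1)) (at_right 0)"
    unfolding S2_def by (intro derivative_intros DERIV_cmult dm2 dV)
  then have "((\<lambda>t. (((\<Sum>i\<in>UNIV. m2 i i t) - (n + 2) * V t) - ((\<Sum>i\<in>UNIV. m2 i i 0) - (n + 2) * V 0)) / (t - 0))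
       \<longlongrightarrow> S2 - (n + 2) * \<Lambda> (\<lambda>x. 1)) (at_right 0)"
    by (simp add: has_field_derivative_iff)
  moreover have "((\<lambda>t. (((\<Sum>i\<in>UNIV. m2 i i t) - (n + 2) * V t) - ((\<Sum>i\<in>UNIV. m2 i i 0) - (n + 2) * V 0)) / (t - 0))
       \<longlongrightarrow> \<Lambda> ?g) (at_right 0)"
  proof (rule Lim_transform_eventually)
    have "(E ?g has_real_derivative \<Lambda> ?g) (at_right 0)"
      by (rule dE) (intro continuous_intros)
    then show "((\<lambda>t. (E ?g t - E ?g 0) / (t - 0)) \<longlongrightarrow> \<Lambda> ?g) (at_right 0)"
      by (simp add: has_field_derivative_iff)
    show "\<forall>\<^sub>F t in at_right 0. (E ?g t - E ?g 0) / (t - 0) =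
      (((\<Sum>i\<in>UNIV. m2 i i t) - (n + 2) * V t) - ((\<Sum>i\<in>UNIV. m2 i i 0) - (n + 2) * V 0)) / (t - 0)"
      using ev by eventually_elim (simp only: e0)
  qed
  ultimately have "S2 - (n + 2) * \<Lambda> (\<lambda>x. 1) = \<Lambda> ?g"
    by (rule tendsto_unique[OF trivial_limit_at_right_real])
  then show ?thesis using le by simp
qed

section \<open>Lebesgue measure on affine subspaces\<close>

lemma orthonormal_frame_finite:
  assumes "orthonormal_frame A (p, B)"
  shows "finite B"
proof -
  have "pairwise orthogonal B" "0 \<notin> B"
    using assms by (auto simp: orthonormal_frame_def)
  then show ?thesis using pairwise_orthogonal_independent independent_imp_finite by blast
qed

lemma affine_lborel_frame:
  fixes A :: "'a::euclidean_space set"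
  assumes "affine A" "A \<noteq> {}"
  obtains p B where "orthonormal_frame A (p, B)"
    "affine_lborel A = distr (\<Pi>\<^sub>M b\<in>B. lborel) borel (\<lambda>y. p + (\<Sum>b\<in>B. y b *\<^sub>R b))"
proof -
  obtain p where p: "p \<in> A" using assms(2) by blast
  have "subspace ((\<lambda>x. x - p) ` A)"
    using affine_diffs_subspace_subtract[OF assms(1) p] .
  then obtain B where "pairwise orthogonal B" "\<And>x. x \<in> B \<Longrightarrow> norm x = 1" "span B = (\<lambda>x. x - p) ` A"
    using orthonormal_basis_subspace by metis
  then have "orthonormal_frame A (p, B)" using p by (auto simp: orthonormal_frame_def)
  then have "orthonormal_frame A (SOME pB. orthonormal_frame A pB)" by (rule someI)
  then show ?thesis
    by (intro that[of "fst (SOME pB. orthonormal_frame A pB)" "snd (SOME pB. orthonormal_frame A pB)"])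
       (simp_all add: affine_lborel_def case_prod_beta)
qed

lemma frame_coordinate:
  assumes B: "pairwise orthogonal B" "\<And>b. b \<in> B \<Longrightarrow> norm b = 1" "finite B" and b: "b \<in> B"
  shows "(\<Sum>c\<in>B. y c *\<^sub>R c) \<bullet> b = y b"
proof -
  have "(\<Sum>c\<in>B. y c *\<^sub>R c) \<bullet> b = (\<Sum>c\<in>B. if c = b then y b else 0)"
    unfolding inner_sum_left
  proof (rule sum.cong)
    show "(y c *\<^sub>R c) \<bullet> b = (if c = b then y b else 0)" if "c \<in> B" for c
      using B(1,2) b that by (auto simp: pairwise_def orthogonal_def dot_square_norm)
  qed simp
  then show ?thesis using B(3) b by simp
qed


lemma sets_affine_lborel [measurable_cong]: "sets (affine_lborel A) = sets borel"
  by (simp add: affine_lborel_def split: prod.split)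

lemma norm_frame_sum:
  assumes B: "pairwise orthogonal B" "\<And>b. b \<in> B \<Longrightarrow> norm b = 1" "finite B"
  shows "norm (\<Sum>b\<in>B. y b *\<^sub>R b) = sqrt (\<Sum>b\<in>B. (y b)\<^sup>2)"
proof -
  have "(\<Sum>c\<in>B. y c *\<^sub>R c) \<bullet> (\<Sum>b\<in>B. y b *\<^sub>R b) = (\<Sum>b\<in>B. y b * ((\<Sum>c\<in>B. y c *\<^sub>R c) \<bullet> b))"
    by (simp add: inner_sum_right)
  also have "\<dots> = (\<Sum>b\<in>B. (y b)\<^sup>2)"
    using frame_coordinate[OF B] by (simp add: power2_eq_square)
  finally show ?thesis by (simp add: norm_eq_sqrt_inner)
qed

text \<open>Local finiteness, via the volume of balls in frame coordinates; it yields
  \<open>\<sigma>\<close>-finiteness, needed for Fubini, and finiteness of the measures on the faces.\<close>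

lemma emeasure_affine_lborel_cball:
  fixes A :: "'a::euclidean_space set"
  assumes A: "affine A" "A \<noteq> {}"
  shows "emeasure (affine_lborel A) (cball c r) < \<infinity>"
proof -
  obtain p B where pB: "orthonormal_frame A (p, B)"
    and eq: "affine_lborel A = distr (\<Pi>\<^sub>M b\<in>B. lborel) borel (\<lambda>y. p + (\<Sum>b\<in>B. y b *\<^sub>R b))"
    using affine_lborel_frame[OF A] .
  have fin: "finite B" by (rule orthonormal_frame_finite[OF pB])
  have B: "pairwise orthogonal B" "\<And>b. b \<in> B \<Longrightarrow> norm b = 1"
    using pB by (auto simp: orthonormal_frame_def)
  define R where "R = \<bar>r\<bar> + dist c p + 1"
  have R: "R > 0" by (simp add: R_def add_nonneg_pos)
  have "emeasure (affine_lborel A) (cball c r) =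
    emeasure (\<Pi>\<^sub>M b\<in>B. lborel) ((\<lambda>y. p + (\<Sum>b\<in>B. y b *\<^sub>R b)) -` cball c r \<inter> space (\<Pi>\<^sub>M b\<in>B. lborel))"
    unfolding eq by (rule emeasure_distr) measurable
  also have "\<dots> \<le> emeasure (\<Pi>\<^sub>M b\<in>B. lborel) ({y. sqrt (\<Sum>b\<in>B. (y b)\<^sup>2) \<le> R} \<inter> space (\<Pi>\<^sub>M b\<in>B. lborel))"
  proof (rule emeasure_mono)
    show "(\<lambda>y. p + (\<Sum>b\<in>B. y b *\<^sub>R b)) -` cball c r \<inter> space (\<Pi>\<^sub>M b\<in>B. lborel)
       \<subseteq> {y. sqrt (\<Sum>b\<in>B. (y b)\<^sup>2) \<le> R} \<inter> space (\<Pi>\<^sub>M b\<in>B. lborel)"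
    proof clarify
      fix y :: "'a \<Rightarrow> real" assume "p + (\<Sum>b\<in>B. y b *\<^sub>R b) \<in> cball c r"
      then have "norm (\<Sum>b\<in>B. y b *\<^sub>R b) \<le> R"
        using dist_triangle2[of p "p + (\<Sum>b\<in>B. y b *\<^sub>R b)" c]
        by (simp add: R_def dist_commute) (simp add: dist_norm)
      then show "sqrt (\<Sum>b\<in>B. (y b)\<^sup>2) \<le> R" by (simp add: norm_frame_sum[OF B fin])
    qed
  qed (use fin in measurable)
  also have "\<dots> < \<infinity>" by (simp add: emeasure_cball_aux[OF fin R])
  finally show ?thesis .
qed

lemma sigma_finite_affine_lborel:
  fixes A :: "'a::euclidean_space set"
  assumes A: "affine A" "A \<noteq> {}"
  shows "sigma_finite_measure (affine_lborel A)"
proof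
  have sp: "space (affine_lborel A) = UNIV"
    using sets_eq_imp_space_eq[OF sets_affine_lborel] by simp
  show "\<exists>C. countable C \<and> C \<subseteq> sets (affine_lborel A) \<and> \<Union> C = space (affine_lborel A) \<and>
      (\<forall>a\<in>C. emeasure (affine_lborel A) a \<noteq> \<infinity>)"
  proof (intro exI conjI ballI)
    show "countable (range (\<lambda>n::nat. cball (0::'a) n))" by simp
    show "range (\<lambda>n::nat. cball (0::'a) n) \<subseteq> sets (affine_lborel A)" by (auto simp: sets_affine_lborel)
    show "\<Union> (range (\<lambda>n::nat. cball (0::'a) n)) = space (affine_lborel A)"
    proof -
      have "x \<in> \<Union> (range (\<lambda>n::nat. cball (0::'a) n))" for x
      proof -
        obtain n :: nat where "norm x \<le> real n" using real_arch_simple by blast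
        then have "x \<in> cball 0 (real n)" by simp
        then show ?thesis by blast
      qed
      then show ?thesis unfolding sp by blast
    qed
    show "emeasure (affine_lborel A) S \<noteq> \<infinity>" if S: "S \<in> range (\<lambda>n::nat. cball (0::'a) n)" for S
    proof -
      obtain n :: nat where "S = cball 0 (real n)" using S by blast
      then show ?thesis using emeasure_affine_lborel_cball[OF A, of 0 "real n"] by simp
    qed
  qed
qed

lemma AE_affine_lborel:
  fixes A :: "'a::euclidean_space set"
  assumes A: "affine A" "A \<noteq> {}"
  shows "AE x in affine_lborel A. x \<in> A"
proof -
  obtain p B where pB: "orthonormal_frame A (p, B)"
    and eq: "affine_lborel A = distr (\<Pi>\<^sub>M b\<in>B. lborel) borel (\<lambda>y. p + (\<Sum>b\<in>B. y b *\<^sub>R b))"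
    using affine_lborel_frame[OF A] .
  have "p + (\<Sum>b\<in>B. y b *\<^sub>R b) \<in> A" for y
  proof -
    have "(\<Sum>b\<in>B. y b *\<^sub>R b) \<in> span B" by (intro span_sum span_scale span_base)
    then show ?thesis using pB by (auto simp: orthonormal_frame_def algebra_simps)
  qed
  moreover have "{x \<in> space borel. x \<in> A} \<in> sets borel"
    using affine_closed[OF A(1)] by (simp add: borel_closed)
  ultimately show ?thesis
    unfolding eq by (subst AE_distr_iff) auto
qed

lemma sets_vol_face [measurable_cong]: "sets (vol_face F) = sets borel"
  by (simp add: vol_face_def sets_affine_lborel)

lemma finite_measure_vol_face:
  fixes F :: "'a::euclidean_space set"
  assumes F: "compact F" "F \<noteq> {}"
  shows "finite_measure (vol_face F)"
proof
  have [measurable]: "F \<in> sets borel" using F by (simp add: borel_compact)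
  obtain R where R: "F \<subseteq> cball 0 R"
    using compact_imp_bounded[OF F(1)] by (auto simp: bounded_iff subset_eq)
  have "emeasure (vol_face F) (space (vol_face F)) = emeasure (affine_lborel (affine hull F)) F"
    using sets_eq_imp_space_eq[OF sets_vol_face[of F]]
    by (simp add: vol_face_def emeasure_density sets_affine_lborel indicator_inter_arith[symmetric])
  also have "\<dots> \<le> emeasure (affine_lborel (affine hull F)) (cball 0 R)"
    by (rule emeasure_mono[OF R]) (simp add: sets_affine_lborel)
  also have "\<dots> < \<infinity>" using emeasure_affine_lborel_cball[of "affine hull F"] F(2) by simp
  finally show "emeasure (vol_face F) (space (vol_face F)) \<noteq> \<infinity>" by simp
qed

text \<open>Uniqueness of Lebesgue measure with the unit ball as normalisation: evaluate
  \<open>\<integral>\<integral> 1\<^sub>B(y) 1\<^sub>A(x + y) dM(x) dy\<close> in both orders, using translation invariance of \<open>M\<close> in one order and of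
  Lebesgue measure in the other. The symmetry of the ball turns the reflected copy of \<open>B\<close> back into \<open>B\<close>.\<close>

lemma translation_invariant_eq_lborel:
  fixes M :: "'a::euclidean_space measure"
  assumes sets[measurable_cong]: "sets M = sets borel" and "sigma_finite_measure M"
    and inv: "\<And>A c. A \<in> sets borel \<Longrightarrow> emeasure M ((\<lambda>x. x + c) -` A) = emeasure M A"
    and ball: "emeasure M (cball 0 1) = emeasure lborel (cball 0 1 :: 'a set)"
  shows "M = lborel"
proof (rule measure_eqI)
  interpret M: sigma_finite_measure M by fact
  interpret P: pair_sigma_finite M "lborel :: 'a measure" ..
  have sp: "space M = UNIV" using sets_eq_imp_space_eq[OF sets] by simp
  fix A assume "A \<in> sets M"
  then have A[measurable]: "A \<in> sets borel" by (simp add: sets)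
  define B where "B = (cball 0 1 :: 'a set)"
  have [measurable]: "B \<in> sets borel" by (simp add: B_def borel_closed)
  have fin: "emeasure lborel B \<noteq> 0" "emeasure lborel B \<noteq> \<infinity>"
    using unit_ball_vol_pos[of "real DIM('a)", OF of_nat_0_le_iff] less_irrefl by (auto simp: B_def emeasure_cball simp del: unit_ball_vol_pos)
  have A': "(\<lambda>x. x + y) -` A \<in> sets borel" for y :: 'a
    using measurable_sets[OF _ A, of "\<lambda>x. x + y" borel] by simp
  have "emeasure lborel B * emeasure M A = (\<integral>\<^sup>+y. indicator B y * emeasure M A \<partial>lborel)"
    by (subst nn_integral_multc) auto
  also have "\<dots> = (\<integral>\<^sup>+y. (\<integral>\<^sup>+x. indicator B y * indicator A (x + y) \<partial>M) \<partial>lborel)"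
  proof (rule nn_integral_cong)
    fix y :: 'a
    have "(\<integral>\<^sup>+x. indicator B y * indicator A (x + y) \<partial>M) = indicator B y * (\<integral>\<^sup>+x. indicator A (x + y) \<partial>M)"
      by (rule nn_integral_cmult) measurable
    also have "(\<integral>\<^sup>+x. indicator A (x + y) \<partial>M) = (\<integral>\<^sup>+x. indicator ((\<lambda>x. x + y) -` A) x \<partial>M)"
      by (simp add: indicator_def)
    also have "\<dots> = emeasure M A"
      using inv[OF A] A' by (simp add: sets)
    finally show "indicator B y * emeasure M A = (\<integral>\<^sup>+x. indicator B y * indicator A (x + y) \<partial>M)" by simp
  qed
  also have "\<dots> = (\<integral>\<^sup>+x. (\<integral>\<^sup>+y. indicator B y * indicator A (x + y) \<partial>lborel) \<partial>M)"
    by (rule P.Fubini') measurable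
  also have "\<dots> = (\<integral>\<^sup>+x. (\<integral>\<^sup>+y. indicator B (y - x) * indicator A y \<partial>lborel) \<partial>M)"
  proof (rule nn_integral_cong)
    fix x :: 'a
    have "(\<integral>\<^sup>+y. indicator B (y - x) * indicator A y \<partial>lborel) =
      (\<integral>\<^sup>+y. indicator B (y - x) * indicator A y \<partial>distr lborel borel ((+) x))"
      by (simp only: lborel_distr_plus)
    also have "\<dots> = (\<integral>\<^sup>+y. indicator B y * indicator A (x + y) \<partial>lborel)"
      by (subst nn_integral_distr) auto
    finally show "(\<integral>\<^sup>+y. indicator B y * indicator A (x + y) \<partial>lborel) =
      (\<integral>\<^sup>+y. indicator B (y - x) * indicator A y \<partial>lborel)" by simp
  qed
  also have "\<dots> = (\<integral>\<^sup>+y. (\<integral>\<^sup>+x. indicator B (y - x) * indicator A y \<partial>M) \<partial>lborel)"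
    by (rule P.Fubini'[symmetric]) measurable
  also have "\<dots> = (\<integral>\<^sup>+y. emeasure lborel B * indicator A y \<partial>lborel)"
  proof (rule nn_integral_cong)
    fix y :: 'a
    have c: "(\<lambda>x. x + - y) -` B = cball y 1"
      by (auto simp: B_def dist_norm norm_minus_commute)
    have "(\<integral>\<^sup>+x. indicator B (y - x) * indicator A y \<partial>M) = (\<integral>\<^sup>+x. indicator B (y - x) \<partial>M) * indicator A y"
      by (rule nn_integral_multc) measurable
    also have "(\<integral>\<^sup>+x. indicator B (y - x) \<partial>M) = (\<integral>\<^sup>+x. indicator (cball y 1) x \<partial>M)"
      by (simp add: B_def indicator_def dist_norm norm_minus_commute)
    also have "\<dots> = emeasure M ((\<lambda>x. x + - y) -` B)" unfolding c by (simp add: sets)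
    also have "\<dots> = emeasure lborel B" by (subst inv) (auto simp: B_def ball)
    finally show "(\<integral>\<^sup>+x. indicator B (y - x) * indicator A y \<partial>M) = emeasure lborel B * indicator A y" .
  qed
  also have "\<dots> = emeasure lborel B * emeasure lborel A" by (simp add: nn_integral_cmult)
  finally show "emeasure M A = emeasure lborel A"
    using fin by (simp add: ennreal_mult_cancel_left)
qed (simp add: sets)

lemma PiM_lborel_translation:
  fixes c :: "'i \<Rightarrow> real"
  assumes B: "finite B"
  shows "distr (\<Pi>\<^sub>M b\<in>B. lborel) (\<Pi>\<^sub>M b\<in>B. lborel) (\<lambda>y. \<lambda>b\<in>B. y b + c b) = (\<Pi>\<^sub>M b\<in>B. lborel :: real measure)"
proof -
  interpret finite_product_sigma_finite "\<lambda>_. lborel :: real measure" B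
    by standard (rule B)
  show ?thesis
  proof (rule PiM_eqI)
    fix A :: "'i \<Rightarrow> real set" assume A: "\<And>i. i \<in> B \<Longrightarrow> A i \<in> sets lborel"
    have A': "(\<lambda>s. s + c i) -` A i \<in> sets lborel" "emeasure lborel ((\<lambda>s. s + c i) -` A i) = emeasure lborel (A i)"
      if "i \<in> B" for i
    proof -
      have Ai: "A i \<in> sets borel" using A[OF that] by simp
      show "(\<lambda>s. s + c i) -` A i \<in> sets lborel"
        using measurable_sets[OF _ Ai, of "\<lambda>s. s + c i" borel] by simp
      have "emeasure lborel (A i) = emeasure (distr lborel borel ((+) (c i))) (A i)"
        by (simp only: lborel_distr_plus)
      also have "\<dots> = emeasure lborel ((\<lambda>s. s + c i) -` A i)"
        using Ai by (subst emeasure_distr) (auto simp: vimage_def add.commute)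
      finally show "emeasure lborel ((\<lambda>s. s + c i) -` A i) = emeasure lborel (A i)" ..
    qed
    have "(\<lambda>y. \<lambda>b\<in>B. y b + c b) -` (\<Pi>\<^sub>E i\<in>B. A i) \<inter> space (\<Pi>\<^sub>M b\<in>B. lborel) = (\<Pi>\<^sub>E i\<in>B. (\<lambda>s. s + c i) -` A i)"
      by (auto simp: space_PiM PiE_iff)
    then show "emeasure (distr (\<Pi>\<^sub>M b\<in>B. lborel) (\<Pi>\<^sub>M b\<in>B. lborel) (\<lambda>y. \<lambda>b\<in>B. y b + c b)) (\<Pi>\<^sub>E i\<in>B. A i)
      = (\<Prod>i\<in>B. emeasure lborel (A i))"
      using A A' B by (subst emeasure_distr) (auto simp: measure_times intro!: sets_PiM_I_finite)
  qed (use B in auto)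
qed

text \<open>Rotation invariance of Lebesgue measure. The Euclidean norm has the same formula in
  every orthonormal coordinate system, so the volume of balls identifies the image measure.\<close>

lemma distr_orthonormal_basis_lborel:
  fixes B :: "'a::euclidean_space set"
  assumes B: "pairwise orthogonal B" "\<And>b. b \<in> B \<Longrightarrow> norm b = 1" and span: "span B = UNIV"
  shows "distr (\<Pi>\<^sub>M b\<in>B. lborel) borel (\<lambda>y. \<Sum>b\<in>B. y b *\<^sub>R b) = (lborel :: 'a measure)"
proof -
  have "independent B" using B by (intro pairwise_orthogonal_independent) (auto dest: B(2))
  then have fin: "finite B" and card: "card B = DIM('a)"
    using independent_imp_finite dim_eq_card_independent[of B] dim_span[of B] by (auto simp: span)
  define M where "M = distr (\<Pi>\<^sub>M b\<in>B. lborel) borel (\<lambda>y. \<Sum>b\<in>B. y b *\<^sub>R b)"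
  have sets: "sets M = sets borel" and sp: "space M = UNIV" by (auto simp: M_def)
  have ball: "emeasure M (cball 0 r) = emeasure lborel (cball 0 r :: 'a set)" if "r > 0" for r
  proof -
    have "emeasure M (cball 0 r) = emeasure (\<Pi>\<^sub>M b\<in>B. lborel)
       ((\<lambda>y. \<Sum>b\<in>B. y b *\<^sub>R b) -` cball 0 r \<inter> space (\<Pi>\<^sub>M b\<in>B. lborel))"
      unfolding M_def by (rule emeasure_distr) measurable
    also have "(\<lambda>y. \<Sum>b\<in>B. y b *\<^sub>R b) -` cball 0 r = {y. sqrt (\<Sum>b\<in>B. (y b)\<^sup>2) \<le> r}"
      by (auto simp: norm_frame_sum[OF B fin])
    finally show ?thesis
      using that by (simp add: emeasure_cball_aux[OF fin that] emeasure_cball card)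
  qed
  have "M = lborel"
  proof (rule translation_invariant_eq_lborel[OF sets])
    show "sigma_finite_measure M"
    proof
      show "\<exists>C. countable C \<and> C \<subseteq> sets M \<and> \<Union> C = space M \<and> (\<forall>a\<in>C. emeasure M a \<noteq> \<infinity>)"
      proof (intro exI conjI ballI)
        show "countable (range (\<lambda>n::nat. cball (0::'a) (Suc n)))" by simp
        show "range (\<lambda>n::nat. cball (0::'a) (Suc n)) \<subseteq> sets M" by (auto simp: sets)
        have "\<exists>n::nat. norm x \<le> 1 + real n" for x :: 'a
          using real_arch_simple[of "norm x"] by (meson add_increasing zero_le_one)
        then show "\<Union> (range (\<lambda>n::nat. cball (0::'a) (Suc n))) = space M" by (auto simp: sp)
        show "emeasure M S \<noteq> \<infinity>" if "S \<in> range (\<lambda>n::nat. cball (0::'a) (Suc n))" for S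
          using that by (auto simp: ball emeasure_cball)
      qed
    qed
    show "emeasure M (cball 0 1) = emeasure lborel (cball 0 1 :: 'a set)" by (rule ball) simp
    fix A :: "'a set" and c assume A[measurable]: "A \<in> sets borel"
    have c: "(\<Sum>b\<in>B. (c \<bullet> b) *\<^sub>R b) = c"
      using B span by (intro orthonormal_basis_expand) (auto simp: fin)
    have "emeasure M A = emeasure (\<Pi>\<^sub>M b\<in>B. lborel) ((\<lambda>y. \<Sum>b\<in>B. y b *\<^sub>R b) -` A \<inter> space (\<Pi>\<^sub>M b\<in>B. lborel))"
      unfolding M_def by (rule emeasure_distr) measurable
    also have "\<dots> = emeasure (distr (\<Pi>\<^sub>M b\<in>B. lborel) (\<Pi>\<^sub>M b\<in>B. lborel) (\<lambda>y. \<lambda>b\<in>B. y b + c \<bullet> b))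
        ((\<lambda>y. \<Sum>b\<in>B. y b *\<^sub>R b) -` A \<inter> space (\<Pi>\<^sub>M b\<in>B. lborel))"
      by (simp only: PiM_lborel_translation[OF fin])
    also have "\<dots> = emeasure (\<Pi>\<^sub>M b\<in>B. lborel) ((\<lambda>y. \<Sum>b\<in>B. y b *\<^sub>R b) -` ((\<lambda>x. x + c) -` A) \<inter> space (\<Pi>\<^sub>M b\<in>B. lborel))"
    proof (subst emeasure_distr)
      show "(\<lambda>y. \<lambda>b\<in>B. y b + c \<bullet> b) \<in> (\<Pi>\<^sub>M b\<in>B. lborel) \<rightarrow>\<^sub>M (\<Pi>\<^sub>M b\<in>B. lborel)" by measurable
      show "(\<lambda>y. \<Sum>b\<in>B. y b *\<^sub>R b) -` A \<inter> space (\<Pi>\<^sub>M b\<in>B. lborel) \<in> sets (\<Pi>\<^sub>M b\<in>B. lborel)"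
        by (rule measurable_sets[OF _ A]) measurable
      show "emeasure (\<Pi>\<^sub>M b\<in>B. lborel) ((\<lambda>y. \<lambda>b\<in>B. y b + c \<bullet> b) -`
          ((\<lambda>y. \<Sum>b\<in>B. y b *\<^sub>R b) -` A \<inter> space (\<Pi>\<^sub>M b\<in>B. lborel)) \<inter> space (\<Pi>\<^sub>M b\<in>B. lborel)) =
        emeasure (\<Pi>\<^sub>M b\<in>B. lborel) ((\<lambda>y. \<Sum>b\<in>B. y b *\<^sub>R b) -` ((\<lambda>x. x + c) -` A) \<inter> space (\<Pi>\<^sub>M b\<in>B. lborel))"
        by (rule arg_cong[of _ _ "emeasure _"])
          (auto simp: space_PiM scaleR_add_left sum.distrib c)
    qed
    also have "\<dots> = emeasure M ((\<lambda>x. x + c) -` A)"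
    proof -
      have "(\<lambda>x. x + c) -` A \<in> sets borel"
        using measurable_sets[OF _ A, of "\<lambda>x. x + c" borel] by simp
      then show ?thesis unfolding M_def by (subst emeasure_distr) auto
    qed
    finally show "emeasure M ((\<lambda>x. x + c) -` A) = emeasure M A" ..
  qed
  then show ?thesis by (simp add: M_def)
qed

text \<open>Fubini along a unit normal. It links the measure on a facet to the volume of the
  thin layers that are added to or cut off the polytope at this facet.\<close>

lemma lborel_eq_hyperplane_product:
  fixes a :: "'a::euclidean_space" and b :: real
  assumes a: "norm a = 1"
  defines "H \<equiv> {x. a \<bullet> x = b}"
  shows "lborel = distr (affine_lborel H \<Otimes>\<^sub>M lborel) borel (\<lambda>(z, s). z + s *\<^sub>R a)"
proof (rule measure_eqI)
  have H: "affine H" "H \<noteq> {}"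
  proof -
    show "affine H" unfolding H_def by (rule affine_hyperplane)
    have "b *\<^sub>R a \<in> H" using a by (simp add: H_def dot_square_norm)
    then show "H \<noteq> {}" by blast
  qed
  obtain p B where pB: "orthonormal_frame H (p, B)"
    and eq: "affine_lborel H = distr (\<Pi>\<^sub>M b\<in>B. lborel) borel (\<lambda>y. p + (\<Sum>b\<in>B. y b *\<^sub>R b))"
    using affine_lborel_frame[OF H] .
  have fin: "finite B" by (rule orthonormal_frame_finite[OF pB])
  have B: "pairwise orthogonal B" "\<And>b. b \<in> B \<Longrightarrow> norm b = 1" "p \<in> H" "span B = (\<lambda>x. x - p) ` H"
    using pB by (auto simp: orthonormal_frame_def)
  have spanB: "span B = {x. a \<bullet> x = 0}"
  proof -
    have "w \<in> (\<lambda>x. x - p) ` H" if "a \<bullet> w = 0" for w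
      using that B(3) by (intro image_eqI[of _ _ "w + p"]) (auto simp: H_def inner_add_right)
    then show ?thesis using B(3) by (auto simp: B(4) H_def inner_diff_right)
  qed
  have orth: "a \<bullet> c = 0" if "c \<in> B" for c
    using span_base[OF that] spanB by blast
  then have aB: "a \<notin> B" using a orth[of a] by (auto simp: dot_square_norm)
  have "span (insert a B) = UNIV"
  proof -
    have "x \<in> span (insert a B)" for x
    proof -
      have "x - (a \<bullet> x) *\<^sub>R a \<in> span B" using a by (simp add: spanB inner_diff_right dot_square_norm)
      then show ?thesis by (auto simp: span_insert)
    qed
    then show ?thesis by auto
  qed
  then have L: "lborel = distr (\<Pi>\<^sub>M b\<in>insert a B. lborel) borel (\<lambda>y. \<Sum>b\<in>insert a B. y b *\<^sub>R b)"
    using B(1,2) a orth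
    by (intro distr_orthonormal_basis_lborel[symmetric])
       (auto simp: pairwise_insert orthogonal_def inner_commute)
  interpret N: sigma_finite_measure "affine_lborel H" by (rule sigma_finite_affine_lborel[OF H])
  interpret product_sigma_finite "\<lambda>_. lborel :: real measure" by standard
  fix A assume "A \<in> sets (lborel :: 'a measure)"
  then have A[measurable]: "A \<in> sets borel" by simp
  have "emeasure lborel A = emeasure (distr lborel borel ((+) p)) A" by (simp only: lborel_distr_plus)
  also have "\<dots> = (\<integral>\<^sup>+x. indicator A x \<partial>distr lborel borel ((+) p))" by simp
  also have "\<dots> = (\<integral>\<^sup>+x. indicator A (p + x) \<partial>lborel)" by (subst nn_integral_distr) auto
  also have "\<dots> = (\<integral>\<^sup>+y. indicator A (p + (\<Sum>b\<in>insert a B. y b *\<^sub>R b)) \<partial>(\<Pi>\<^sub>M b\<in>insert a B. lborel))"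
    by (subst L) (subst nn_integral_distr, measurable)
  also have "\<dots> = (\<integral>\<^sup>+y. \<integral>\<^sup>+s. indicator A (p + (\<Sum>b\<in>insert a B. (y(a := s)) b *\<^sub>R b)) \<partial>lborel \<partial>(\<Pi>\<^sub>M b\<in>B. lborel))"
    by (rule product_nn_integral_insert[OF fin aB]) measurable
  also have "\<dots> = (\<integral>\<^sup>+y. \<integral>\<^sup>+s. indicator A (p + (\<Sum>b\<in>B. y b *\<^sub>R b) + s *\<^sub>R a) \<partial>lborel \<partial>(\<Pi>\<^sub>M b\<in>B. lborel))"
  proof -
    have "(\<Sum>b\<in>B. (y(a := s)) b *\<^sub>R b) = (\<Sum>b\<in>B. y b *\<^sub>R b)" for y s
      using aB by (intro sum.cong) auto
    then show ?thesis using fin aB by (simp add: algebra_simps)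
  qed
  also have "\<dots> = (\<integral>\<^sup>+z. \<integral>\<^sup>+s. indicator A (z + s *\<^sub>R a) \<partial>lborel \<partial>affine_lborel H)"
    unfolding eq by (subst nn_integral_distr) auto
  also have "\<dots> = (\<integral>\<^sup>+x. indicator A (fst x + snd x *\<^sub>R a) \<partial>(affine_lborel H \<Otimes>\<^sub>M lborel))"
    by (subst lborel.nn_integral_fst[symmetric]) auto
  also have "\<dots> = emeasure (distr (affine_lborel H \<Otimes>\<^sub>M lborel) borel (\<lambda>(z, s). z + s *\<^sub>R a)) A"
    by (subst nn_integral_indicator[symmetric], simp, subst nn_integral_distr) (auto simp: case_prod_beta)
  finally show "emeasure lborel A = emeasure (distr (affine_lborel H \<Otimes>\<^sub>M lborel) borel (\<lambda>(z, s). z + s *\<^sub>R a)) A" .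
qed simp

section \<open>Projection onto the cone of small perturbations\<close>

text \<open>The supremum over the Borel subsets of \<open>A\<close> is attained at \<open>{x \<in> A. 0 \<le> f x}\<close>.\<close>

lemma positive_part_density:
  fixes \<nu> :: "'a::topological_space measure"
  assumes [measurable_cong]: "sets \<nu> = sets borel" and f: "integrable \<nu> f"
    and \<mu>: "\<And>A. A \<in> sets borel \<Longrightarrow> \<mu> A = (LINT x:A|\<nu>. f x)"
  shows "positive_part \<mu> = density \<nu> (\<lambda>x. ennreal (f x))"
proof -
  have space: "space \<nu> = UNIV" using sets_eq_imp_space_eq[OF assms(1)] by simp
  have [measurable]: "f \<in> borel_measurable \<nu>" using f by auto
  have nn: "emeasure (density \<nu> (\<lambda>x. ennreal (f x))) A = ennreal (LINT x:A|\<nu>. max 0 (f x))"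
    and int: "set_integrable \<nu> A f" "set_integrable \<nu> A (\<lambda>x. max 0 (f x))"
    if A[measurable]: "A \<in> sets borel" for A
  proof -
    have "set_integrable \<nu> UNIV f" "set_integrable \<nu> UNIV (\<lambda>x. max 0 (f x))"
      using f by (auto simp: set_integrable_def)
    then show i: "set_integrable \<nu> A f" "set_integrable \<nu> A (\<lambda>x. max 0 (f x))"
      by (auto intro: set_integrable_subset)
    have "emeasure (density \<nu> (\<lambda>x. ennreal (f x))) A = (\<integral>\<^sup>+x. ennreal (indicator A x *\<^sub>R max 0 (f x)) \<partial>\<nu>)"
      by (subst emeasure_density) (auto intro!: nn_integral_cong simp: indicator_def max_def ennreal_neg)
    also have "\<dots> = ennreal (LINT x:A|\<nu>. max 0 (f x))"
      unfolding set_lebesgue_integral_def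
      by (rule nn_integral_eq_integral) (use i in \<open>auto simp: set_integrable_def\<close>)
    finally show "emeasure (density \<nu> (\<lambda>x. ennreal (f x))) A = ennreal (LINT x:A|\<nu>. max 0 (f x))" .
  qed
  have "(SUP B\<in>{B \<in> sets borel. B \<subseteq> A}. ennreal (\<mu> B)) = emeasure (density \<nu> (\<lambda>x. ennreal (f x))) A"
    if A[measurable]: "A \<in> sets borel" for A
  proof (rule antisym)
    show "(SUP B\<in>{B \<in> sets borel. B \<subseteq> A}. ennreal (\<mu> B)) \<le> emeasure (density \<nu> (\<lambda>x. ennreal (f x))) A"
    proof (rule SUP_least, clarify)
      fix B :: "'a set" assume B: "B \<in> sets borel" "B \<subseteq> A"
      have "(LINT x:B|\<nu>. f x) \<le> (LINT x:A|\<nu>. max 0 (f x))"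
        using int[OF A] int[OF B(1)] B(2)
        unfolding set_lebesgue_integral_def set_integrable_def
        by (intro integral_mono) (auto simp: indicator_def)
      then show "ennreal (\<mu> B) \<le> emeasure (density \<nu> (\<lambda>x. ennreal (f x))) A"
        by (simp add: nn \<mu> B ennreal_leI)
    qed
    define B where "B = {x \<in> space \<nu>. 0 \<le> f x} \<inter> A"
    have B: "B \<in> sets borel"
      unfolding B_def assms(1)[symmetric] by measurable
    have "(LINT x:A|\<nu>. max 0 (f x)) = \<mu> B"
      unfolding \<mu>[OF B] set_lebesgue_integral_def
      by (intro Bochner_Integration.integral_cong) (auto simp: B_def indicator_def space)
    then show "emeasure (density \<nu> (\<lambda>x. ennreal (f x))) A \<le> (SUP B\<in>{B \<in> sets borel. B \<subseteq> A}. ennreal (\<mu> B))"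
      using B by (auto simp: nn B_def intro: SUP_upper)
  qed
  then have "positive_part \<mu> = measure_of UNIV (sets borel) (emeasure (density \<nu> (\<lambda>x. ennreal (f x))))"
    unfolding positive_part_def
    by (intro measure_of_eq) (auto simp: sigma_algebra.sigma_sets_eq[OF sets.sigma_algebra_axioms[of borel, simplified]])
  also have "\<dots> = density \<nu> (\<lambda>x. ennreal (f x))"
    using measure_of_of_measure[of "density \<nu> (\<lambda>x. ennreal (f x))"] by (simp add: space assms(1))
  finally show ?thesis .
qed

lemma signed_integral_density:
  fixes \<nu> :: "'a::topological_space measure"
  assumes sets[measurable_cong]: "sets \<nu> = sets borel" and f: "integrable \<nu> f"
    and \<mu>: "\<And>A. A \<in> sets borel \<Longrightarrow> \<mu> A = (LINT x:A|\<nu>. f x)"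
    and X[measurable]: "X \<in> sets borel" and AE: "AE x in \<nu>. x \<in> X"
    and g[measurable]: "g \<in> borel_measurable borel" and fg: "integrable \<nu> (\<lambda>x. f x * g x)"
  shows "signed_integral \<mu> X g = (LINT x|\<nu>. f x * g x)"
proof -
  have [measurable]: "f \<in> borel_measurable \<nu>" using f by auto
  have p: "positive_part \<mu> = density \<nu> (\<lambda>x. ennreal (max 0 (f x)))"
    by (subst positive_part_density[OF sets f \<mu>]) (auto intro!: arg_cong2[of _ _ _ _ density] simp: max_def ennreal_neg)
  have "integrable \<nu> (\<lambda>x. - f x)" using f by simp
  moreover have "- \<mu> A = (LINT x:A|\<nu>. - f x)" if "A \<in> sets borel" for A
    using \<mu>[OF that] by (simp add: set_lebesgue_integral_def)
  ultimately have "positive_part (\<lambda>A. - \<mu> A) = density \<nu> (\<lambda>x. ennreal (- f x))"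
    by (rule positive_part_density[OF sets])
  then have m: "positive_part (\<lambda>A. - \<mu> A) = density \<nu> (\<lambda>x. ennreal (max 0 (- f x)))"
    by (auto intro!: arg_cong2[of _ _ _ _ density] simp: max_def ennreal_neg)
  have i1: "(LINT x:X|density \<nu> (\<lambda>x. ennreal (max 0 (h x))). g x) = (LINT x|\<nu>. max 0 (h x) * g x)"
    if [measurable]: "h \<in> borel_measurable \<nu>" for h
  proof -
    have "(LINT x:X|density \<nu> (\<lambda>x. ennreal (max 0 (h x))). g x) = (LINT x|\<nu>. max 0 (h x) *\<^sub>R (indicator X x *\<^sub>R g x))"
      unfolding set_lebesgue_integral_def by (rule integral_density) auto
    also have "\<dots> = (LINT x|\<nu>. max 0 (h x) * g x)"
      using AE by (intro integral_cong_AE) auto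
    finally show ?thesis .
  qed
  have "\<bar>max 0 a * b\<bar> \<le> \<bar>a * b\<bar>" "\<bar>max 0 (- a) * b\<bar> \<le> \<bar>a * b\<bar>" for a b :: real
    by (auto simp: abs_mult intro!: mult_right_mono)
  then have i2: "integrable \<nu> (\<lambda>x. max 0 (f x) * g x)" "integrable \<nu> (\<lambda>x. max 0 (- f x) * g x)"
    by (auto intro!: Bochner_Integration.integrable_bound[OF fg])
  have "signed_integral \<mu> X g = (LINT x|\<nu>. max 0 (f x) * g x) - (LINT x|\<nu>. max 0 (- f x) * g x)"
    unfolding signed_integral_def p m by (intro arg_cong2[of _ _ _ _ minus] i1) measurable
  also have "\<dots> = (LINT x|\<nu>. max 0 (f x) * g x - max 0 (- f x) * g x)"
    using i2 by simp
  also have "\<dots> = (LINT x|\<nu>. f x * g x)"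
    by (intro Bochner_Integration.integral_cong) (auto simp: max_def)
  finally show ?thesis .
qed

lemma square_integrable_mult:
  assumes "square_integrable M f" "square_integrable M g"
  shows "integrable M (\<lambda>x. f x * g x)"
proof -
  have [measurable]: "f \<in> borel_measurable M" "g \<in> borel_measurable M"
    and i: "integrable M (\<lambda>x. (f x)\<^sup>2 + (g x)\<^sup>2)"
    using assms by (auto simp: square_integrable_def)
  have "\<bar>a * b\<bar> \<le> a\<^sup>2 + b\<^sup>2" for a b :: real
  proof -
    have "2 * \<bar>a * b\<bar> \<le> a\<^sup>2 + b\<^sup>2"
      using sum_squares_bound[of "\<bar>a\<bar>" "\<bar>b\<bar>"] by (simp add: abs_mult)
    then show ?thesis using abs_ge_zero[of "a * b"] by linarith
  qed
  then show ?thesis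
    by (intro Bochner_Integration.integrable_bound[OF i]) auto
qed

lemma L2_dist_ae_class:
  assumes [measurable]: "f \<in> borel_measurable M" "g \<in> borel_measurable M"
  shows "L2_dist M (ae_class M f) (ae_class M g) = sqrt (LINT x|M. (f x - g x)\<^sup>2)"
proof -
  have "f \<in> ae_class M f" "g \<in> ae_class M g" by (auto simp: ae_class_def)
  then have "(SOME h. h \<in> ae_class M f) \<in> ae_class M f" "(SOME h. h \<in> ae_class M g) \<in> ae_class M g"
    by (metis empty_iff some_in_eq)+
  then have [measurable]: "(SOME h. h \<in> ae_class M f) \<in> borel_measurable M" "(SOME h. h \<in> ae_class M g) \<in> borel_measurable M"
    and "AE x in M. (SOME h. h \<in> ae_class M f) x = f x" "AE x in M. (SOME h. h \<in> ae_class M g) x = g x"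
    by (auto simp: ae_class_def)
  then have "(LINT x|M. ((SOME h. h \<in> ae_class M f) x - (SOME h. h \<in> ae_class M g) x)\<^sup>2) = (LINT x|M. (f x - g x)\<^sup>2)"
    by (intro integral_cong_AE) auto
  then show ?thesis by (simp add: L2_dist_def)
qed

text \<open>If \<open>g\<close> has nonpositive inner product with every element of \<open>C\<close>, expanding the square
  gives \<open>\<parallel>g - f\<parallel>\<^sup>2 \<ge> \<parallel>g\<parallel>\<^sup>2 + \<parallel>f\<parallel>\<^sup>2\<close>, which yields at once that 0 is a nearest point and that it is the only one.\<close>

lemma metric_projection_eq_zero:
  assumes C: "C \<subseteq> L2 M" and zero: "ae_class M (\<lambda>x. 0) \<in> C" and g: "square_integrable M g"
    and polar: "\<And>f. square_integrable M f \<Longrightarrow> ae_class M f \<in> C \<Longrightarrow> (LINT x|M. f x * g x) \<le> 0"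
  shows "metric_projection M C (ae_class M g) = ae_class M (\<lambda>x. 0)"
proof -
  have [measurable]: "g \<in> borel_measurable M" using g by (simp add: square_integrable_def)
  have d0: "L2_dist M (ae_class M g) (ae_class M (\<lambda>x. 0)) = sqrt (LINT x|M. (g x)\<^sup>2)"
    by (simp add: L2_dist_ae_class)
  have key: "L2_dist M (ae_class M g) (ae_class M f) \<ge> sqrt ((LINT x|M. (g x)\<^sup>2) + (LINT x|M. (f x)\<^sup>2))"
    if f: "square_integrable M f" "ae_class M f \<in> C" for f
  proof -
    have [measurable]: "f \<in> borel_measurable M" using f by (simp add: square_integrable_def)
    have i: "integrable M (\<lambda>x. (g x)\<^sup>2)" "integrable M (\<lambda>x. (f x)\<^sup>2)" "integrable M (\<lambda>x. f x * g x)"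
      using f g square_integrable_mult[OF f(1) g] by (auto simp: square_integrable_def)
    have "(LINT x|M. (g x - f x)\<^sup>2) = (LINT x|M. (g x)\<^sup>2 + (f x)\<^sup>2 - 2 * (f x * g x))"
      by (simp add: power2_diff algebra_simps)
    also have "\<dots> = (LINT x|M. (g x)\<^sup>2) + (LINT x|M. (f x)\<^sup>2) - 2 * (LINT x|M. f x * g x)"
      using i by simp
    finally show ?thesis using polar[OF f] by (simp add: L2_dist_ae_class)
  qed
  have cl: "\<exists>f. square_integrable M f \<and> w = ae_class M f" if "w \<in> C" for w
    using C that by (auto simp: L2_def)
  show ?thesis
    unfolding metric_projection_def
  proof (rule the_equality, intro conjI ballI)
    fix w assume w: "w \<in> C"
    then obtain f where f: "square_integrable M f" "w = ae_class M f" using cl by blast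
    have "(LINT x|M. (f x)\<^sup>2) \<ge> 0" by simp
    then have "sqrt (LINT x|M. (g x)\<^sup>2) \<le> sqrt ((LINT x|M. (g x)\<^sup>2) + (LINT x|M. (f x)\<^sup>2))" by simp
    also have "\<dots> \<le> L2_dist M (ae_class M g) w"
      using key[OF f(1)] w unfolding f(2) by blast
    finally show "L2_dist M (ae_class M g) (ae_class M (\<lambda>x. 0)) \<le> L2_dist M (ae_class M g) w"
      unfolding d0 .
  next
    fix v assume v: "v \<in> C \<and> (\<forall>w\<in>C. L2_dist M (ae_class M g) v \<le> L2_dist M (ae_class M g) w)"
    then obtain f where f: "square_integrable M f" "v = ae_class M f" using cl by blast
    have [measurable]: "f \<in> borel_measurable M" using f by (simp add: square_integrable_def)
    have "L2_dist M (ae_class M g) v \<le> sqrt (LINT x|M. (g x)\<^sup>2)" using v zero d0 by metis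
    moreover have "sqrt ((LINT x|M. (g x)\<^sup>2) + (LINT x|M. (f x)\<^sup>2)) \<le> L2_dist M (ae_class M g) v"
      using key[OF f(1)] v unfolding f(2) by blast
    ultimately have "sqrt ((LINT x|M. (g x)\<^sup>2) + (LINT x|M. (f x)\<^sup>2)) \<le> sqrt (LINT x|M. (g x)\<^sup>2)"
      by linarith
    moreover have "(LINT x|M. (f x)\<^sup>2) \<ge> 0" by simp
    ultimately have "(LINT x|M. (f x)\<^sup>2) = 0" by simp
    then have "AE x in M. f x = 0"
      using integral_nonneg_eq_0_iff_AE[of M "\<lambda>x. (f x)\<^sup>2"] f(1) by (simp add: square_integrable_def)
    then have "(AE x in M. h x = f x) \<longleftrightarrow> (AE x in M. h x = 0)" for h
    proof (intro iffI)
      assume "AE x in M. h x = f x"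
      with \<open>AE x in M. f x = 0\<close> show "AE x in M. h x = 0" by eventually_elim simp
    next
      assume "AE x in M. h x = 0"
      with \<open>AE x in M. f x = 0\<close> show "AE x in M. h x = f x" by eventually_elim simp
    qed
    then show "v = ae_class M (\<lambda>x. 0)" by (simp add: f ae_class_def)
  qed (rule zero)
qed

lemma sets_vol_faces [measurable_cong]: "sets (vol_faces P) = sets borel"
  unfolding vol_faces_def
  by (simp add: sigma_algebra.sigma_sets_eq[OF sets.sigma_algebra_axioms[of borel, simplified]])

lemma emeasure_vol_faces:
  assumes "A \<in> sets borel"
  shows "emeasure (vol_faces P) A = (\<Sum>F\<in>proper_faces P. emeasure (vol_face F) A)"
proof (rule emeasure_measure_of[OF vol_faces_def])
  show "positive (sets (vol_faces P)) (\<lambda>A. \<Sum>F\<in>proper_faces P. emeasure (vol_face F) A)"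
    by (simp add: positive_def)
  show "countably_additive (sets (vol_faces P)) (\<lambda>A. \<Sum>F\<in>proper_faces P. emeasure (vol_face F) A)"
  proof (rule countably_additiveI)
    fix A :: "nat \<Rightarrow> 'a set" assume A: "range A \<subseteq> sets (vol_faces P)" "disjoint_family A"
    have "(\<lambda>i. emeasure (vol_face F) (A i)) sums emeasure (vol_face F) (\<Union>i. A i)" for F :: "'a set"
      using A suminf_emeasure[of A "vol_face F"] summable_sums[OF summableI]
      by (metis sets_vol_face sets_vol_faces)
    then have "(\<lambda>i. \<Sum>F\<in>proper_faces P. emeasure (vol_face F) (A i)) sums (\<Sum>F\<in>proper_faces P. emeasure (vol_face F) (\<Union>i. A i))"
      by (intro sums_sum)
    then show "(\<Sum>i. \<Sum>F\<in>proper_faces P. emeasure (vol_face F) (A i)) = (\<Sum>F\<in>proper_faces P. emeasure (vol_face F) (\<Union>i. A i))"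
      by (rule sums_unique[symmetric])
  qed
qed (use assms in \<open>auto simp: sets_vol_faces\<close>)

lemma finite_measure_vol_faces:
  assumes "polytope P"
  shows "finite_measure (vol_faces P)"
proof
  have "emeasure (vol_face F) UNIV < \<infinity>" if "F \<in> proper_faces P" for F
  proof -
    have "compact F" "F \<noteq> {}"
      using that assms face_of_polytope_polytope polytope_imp_compact by (auto simp: proper_faces_def)
    then interpret finite_measure "vol_face F" by (rule finite_measure_vol_face)
    show ?thesis using emeasure_finite[of UNIV] by (metis infinity_ennreal_def less_top)
  qed
  moreover have "space (vol_faces P) = UNIV" by (simp add: vol_faces_def)
  moreover have "finite (proper_faces P)"
    using finite_polytope_faces[OF assms] by (rule rev_finite_subset) (auto simp: proper_faces_def)
  ultimately have "emeasure (vol_faces P) (space (vol_faces P)) < \<infinity>"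
    by (simp add: emeasure_vol_faces)
  then show "emeasure (vol_faces P) (space (vol_faces P)) \<noteq> \<infinity>" by simp
qed

lemma AE_vol_faces_frontier:
  fixes P :: "'a::euclidean_space set"
  assumes "polytope P"
  shows "AE x in vol_faces P. x \<in> frontier P"
proof -
  have P: "convex P" "closed P" using assms polytope_imp_convex polytope_imp_closed by auto
  have "emeasure (vol_face F) (- frontier P) = 0" if F: "F \<in> proper_faces P" for F
  proof -
    have f: "F face_of P" "F \<noteq> P" using F by (auto simp: proper_faces_def)
    have [measurable]: "F \<in> sets borel" using face_of_imp_closed[OF P f(1)] by (rule borel_closed)
    have "F \<inter> interior P = {}"
      using face_of_disjoint_interior[OF f] .
    moreover have "F \<subseteq> closure P" using face_of_imp_subset[OF f(1)] closure_subset by blast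
    ultimately have sub: "F \<subseteq> frontier P" unfolding frontier_def by blast
    have [measurable_cong]: "sets (affine_lborel (affine hull F)) = sets borel"
      by (simp add: affine_lborel_def split: prod.split)
    have [measurable]: "frontier P \<in> sets borel" by (simp add: borel_closed)
    have "emeasure (vol_face F) (- frontier P) = (\<integral>\<^sup>+x. indicator F x * indicator (- frontier P) x \<partial>affine_lborel (affine hull F))"
      unfolding vol_face_def by (rule emeasure_density) auto
    also have "\<dots> = (\<integral>\<^sup>+x. 0 \<partial>affine_lborel (affine hull F))"
      using sub by (intro nn_integral_cong) (auto simp: indicator_def)
    finally show ?thesis by simp
  qed
  moreover have b: "- frontier P \<in> sets borel" by (simp add: borel_open open_Compl)
  ultimately have "emeasure (vol_faces P) (- frontier P) = 0" by (simp add: emeasure_vol_faces)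
  then show ?thesis
    by (intro AE_I[of _ _ "- frontier P"]) (use b in \<open>auto simp: sets_vol_faces\<close>)
qed

lemma zero_in_W2:
  fixes P :: "(real ^ 'n) set"
  assumes "full_dim_convex_body P"
  shows "ae_class (vol_faces P) (\<lambda>x. 0) \<in> W2 P"
proof -
  have d: "((\<lambda>t::real. c) has_vector_derivative 0) (at 0 within {0..1})" for c :: real
    by (rule has_vector_derivative_const)
  have "(\<lambda>A. 0) \<in> small_perturbations P"
    unfolding small_perturbations_def
  proof (intro CollectI conjI exI[of _ "\<lambda>t. P"] allI impI)
    show "(\<lambda>A. 0) \<in> signed_measures_on (frontier P)"
      by (simp add: signed_measures_on_def signed_measure_def)
    show "weakly_differentiable (\<lambda>t. P)"
      using assms by (simp add: weakly_differentiable_def)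
    show "weak_derivative (\<lambda>t. P) f = signed_integral (\<lambda>A. 0) (frontier P) f" for f
      unfolding weak_derivative_def signed_integral_def
      by (subst vector_derivative_within[OF _ d]) (simp_all add: at_within_Icc_at_right)
  qed simp
  then show ?thesis
    unfolding W2_def L2_def square_integrable_def ae_class_def set_lebesgue_integral_def
    by (auto intro!: bexI[of _ "\<lambda>x. 0"] exI[of _ "\<lambda>x. 0"] bexI[of _ "\<lambda>A. 0"])
qed

text \<open>An element of the cone is the density of a small perturbation, so its inner product
  with \<open>g\<close> is the derivative of the integral of \<open>g\<close> along a family of bodies, which is nonpositive at a local
  maximizer.\<close>

lemma metric_projection_W2_eq_zero:
  fixes P :: "(real ^ 'n) set"
  assumes P: "polytope P" and iso: "isotropic P" and max: "isotropic_constant_local_maximizer P"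
  defines "g \<equiv> \<lambda>x :: real ^ 'n. (norm x)\<^sup>2 - real CARD('n) - 2"
  shows "metric_projection (vol_faces P) (W2 P) (ae_class (vol_faces P) g) = ae_class (vol_faces P) (\<lambda>x. 0)"
proof (rule metric_projection_eq_zero)
  have Pb: "full_dim_convex_body P" using max by (simp add: isotropic_constant_local_maximizer_def)
  have gc: "continuous_on UNIV g" unfolding g_def by (intro continuous_intros)
  have gm[measurable]: "g \<in> borel_measurable borel" by (rule borel_measurable_continuous_onI[OF gc])
  interpret finite_measure "vol_faces P" by (rule finite_measure_vol_faces[OF P])
  note AE = AE_vol_faces_frontier[OF P]
  have "compact (g ` frontier P)"
    using polytope_imp_compact[OF P] gc
    by (intro compact_continuous_image) (auto intro: continuous_on_subset compact_frontier)
  then obtain R where R: "\<And>x. x \<in> frontier P \<Longrightarrow> \<bar>g x\<bar> \<le> R"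
    using compact_imp_bounded by (fastforce simp: bounded_iff)
  have "AE x in vol_faces P. norm ((g x)\<^sup>2) \<le> R\<^sup>2"
    using AE
  proof eventually_elim
    case (elim x)
    have "\<bar>g x\<bar> \<le> \<bar>R\<bar>" using R[OF elim] by linarith
    then show ?case by (simp add: abs_le_square_iff)
  qed
  then have "integrable (vol_faces P) (\<lambda>x. (g x)\<^sup>2)"
    by (rule integrable_const_bound) auto
  then show g: "square_integrable (vol_faces P) g"
    by (simp add: square_integrable_def)
  show "W2 P \<subseteq> L2 (vol_faces P)" by (auto simp: W2_def)
  show "ae_class (vol_faces P) (\<lambda>x. 0) \<in> W2 P" by (rule zero_in_W2[OF Pb])
  fix h assume h: "square_integrable (vol_faces P) h" "ae_class (vol_faces P) h \<in> W2 P"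
  have [measurable]: "h \<in> borel_measurable (vol_faces P)" using h by (simp add: square_integrable_def)
  obtain f \<mu> where f: "f \<in> ae_class (vol_faces P) h" and \<mu>: "\<mu> \<in> small_perturbations P"
    and eq: "\<And>A. A \<in> sets borel \<Longrightarrow> \<mu> A = (LINT x:A|vol_faces P. f x)"
    using h(2) by (auto simp: W2_def)
  have [measurable]: "f \<in> borel_measurable (vol_faces P)" and fh: "AE x in vol_faces P. f x = h x"
    using f by (auto simp: ae_class_def)
  have one: "square_integrable (vol_faces P) (\<lambda>x. 1)" by (simp add: square_integrable_def)
  have hi: "integrable (vol_faces P) h" using square_integrable_mult[OF h(1) one] by simp
  have fi: "integrable (vol_faces P) f"
    using fh by (intro integrable_cong_AE_imp[OF hi]) auto
  have fg: "integrable (vol_faces P) (\<lambda>x. f x * g x)"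
    using fh by (intro integrable_cong_AE_imp[OF square_integrable_mult[OF h(1) g]]) auto
  obtain K where K: "weakly_differentiable K" "K 0 = P"
    and D: "\<And>f. continuous_on UNIV f \<Longrightarrow> weak_derivative K f = signed_integral \<mu> (frontier P) f"
    using \<mu> by (auto simp: small_perturbations_def)
  have at: "at 0 within {0..1::real} = at_right 0" by (rule at_within_Icc_at_right) simp
  have "weak_derivative K g \<le> 0"
    unfolding g_def
  proof (rule local_maximizer_first_order[OF iso max, of K "weak_derivative K"])
    have "\<forall>\<^sub>F t in at_right 0. t \<in> {0..1::real}"
      using eventually_at_right_real[of 0 "1::real"] by (auto elim!: eventually_mono)
    then show "\<forall>\<^sub>F t in at_right 0. full_dim_convex_body (K t)"
      using K(1) by (auto simp: weakly_differentiable_def elim!: eventually_mono)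
    show "K 0 = P" by fact
    show "((\<lambda>t. LINT x:K t|lborel. f x) has_real_derivative weak_derivative K f) (at_right 0)"
      if "continuous_on UNIV f" for f
      using K(1) that unfolding weakly_differentiable_def weak_derivative_def at
      by (simp add: has_real_derivative_iff_has_vector_derivative vector_derivative_works[symmetric])
  qed
  also have "weak_derivative K g = (LINT x|vol_faces P. f x * g x)"
    unfolding D[OF gc] by (rule signed_integral_density[OF sets_vol_faces fi eq _ AE gm fg]) auto
  also have "\<dots> = (LINT x|vol_faces P. h x * g x)"
    using fh by (intro integral_cong_AE) auto
  finally show "(LINT x|vol_faces P. h x * g x) \<le> 0" .
qed

section \<open>Moving a facet\<close>

text \<open>The relative boundary of a convex set in a hyperplane has measure 0 in the hyperplane.
  This follows from the full-dimensional fact that frontiers of convex sets are negligible, applied to the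
  cylinder over \<open>F\<close>, because lines in the direction \<open>a\<close> through relative boundary points stay in the frontier.\<close>

lemma AE_rel_interior_in_hyperplane:
  fixes F :: "'a::euclidean_space set" and b :: real
  assumes F: "convex F" "F \<subseteq> {x. a \<bullet> x = b}" and a: "norm a = 1"
  shows "AE z in affine_lborel {x. a \<bullet> x = b}. z \<in> F \<longrightarrow> z \<in> rel_interior F"
proof -
  define H where "H = {x. a \<bullet> x = b}"
  define C where "C = {x. x + (b - a \<bullet> x) *\<^sub>R a \<in> F}"
  have aa: "a \<bullet> a = 1" using a by (simp add: dot_square_norm)
  have H: "affine H" "H \<noteq> {}"
  proof -
    show "affine H" unfolding H_def by (rule affine_hyperplane)
    have "b *\<^sub>R a \<in> H" using aa by (simp add: H_def)
    then show "H \<noteq> {}" by blast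
  qed
  interpret N: sigma_finite_measure "affine_lborel H" by (rule sigma_finite_affine_lborel[OF H])
  interpret P: pair_sigma_finite "affine_lborel H" "lborel :: real measure" ..
  have "convex C"
    unfolding convex_def
  proof (intro ballI allI impI)
    fix x y and u v :: real
    assume xy: "x \<in> C" "y \<in> C" and uv: "0 \<le> u" "0 \<le> v" "u + v = 1"
    have "u *\<^sub>R (x + (b - a \<bullet> x) *\<^sub>R a) + v *\<^sub>R (y + (b - a \<bullet> y) *\<^sub>R a) \<in> F"
      using xy uv F(1) by (intro convexD) (auto simp: C_def)
    also have "u *\<^sub>R (x + (b - a \<bullet> x) *\<^sub>R a) + v *\<^sub>R (y + (b - a \<bullet> y) *\<^sub>R a) =
      (u *\<^sub>R x + v *\<^sub>R y) + ((u + v) * b - a \<bullet> (u *\<^sub>R x + v *\<^sub>R y)) *\<^sub>R a"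
      by (simp add: algebra_simps inner_add_right)
    finally show "u *\<^sub>R x + v *\<^sub>R y \<in> C" by (simp add: C_def uv)
  qed
  then have "negligible (frontier C)" by (rule negligible_convex_frontier)
  then have "frontier C \<in> null_sets lborel"
    by (simp add: negligible_iff_null_sets null_sets_completion_iff borel_closed)
  then have "AE x in lborel. x \<notin> frontier C" by (rule AE_not_in)
  then have "AE x in distr (affine_lborel H \<Otimes>\<^sub>M lborel) borel (\<lambda>(z, s). z + s *\<^sub>R a). x \<notin> frontier C"
    unfolding H_def by (subst (asm) lborel_eq_hyperplane_product[OF a, of b])
  then have "AE x in affine_lborel H \<Otimes>\<^sub>M lborel. (case x of (z, s) \<Rightarrow> z + s *\<^sub>R a) \<notin> frontier C"
    by (subst (asm) AE_distr_iff) (auto simp: borel_open open_Compl[unfolded Compl_eq])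
  then have "AE z in affine_lborel H. AE s in lborel. (case (z, s) of (z, s) \<Rightarrow> z + s *\<^sub>R a) \<notin> frontier C"
    by (rule P.AE_pair)
  then have "AE z in affine_lborel H. z \<in> F \<longrightarrow> z \<in> rel_interior F"
  proof eventually_elim
    case (elim z)
    have "ae_filter (lborel :: real measure) \<noteq> bot" by (simp add: ae_filter_eq_bot_iff)
    from eventually_happens'[OF this elim] obtain s where s: "z + s *\<^sub>R a \<notin> frontier C" by auto
    show ?case
    proof
      assume z: "z \<in> F"
      then have az: "a \<bullet> z = b" using F(2) by auto
      have "z + s *\<^sub>R a \<in> C" using z az aa by (simp add: C_def inner_add_right)
      then have "z + s *\<^sub>R a \<in> interior C" using s closure_subset by (auto simp: frontier_def)
      then obtain e where e: "e > 0" "ball (z + s *\<^sub>R a) e \<subseteq> C" by (auto simp: mem_interior)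
      have "ball z e \<inter> affine hull F \<subseteq> F"
      proof
        fix w assume w: "w \<in> ball z e \<inter> affine hull F"
        have "affine hull F \<subseteq> H" using F(2) H(1) by (simp add: hull_minimal H_def)
        then have aw: "a \<bullet> w = b" using w by (auto simp: H_def)
        have "w + s *\<^sub>R a \<in> C" using w e by (auto simp: dist_norm)
        then show "w \<in> F" using aw aa by (simp add: C_def inner_add_right)
      qed
      then show "z \<in> rel_interior F" using z e by (auto simp: mem_rel_interior_ball)
    qed
  qed
  then show ?thesis unfolding H_def .
qed

text \<open>The substitution \<open>s = c \<tau>\<close> treats layers on either side of a facet uniformly: it
  turns the signed integral between the levels 0 and \<open>c\<close> into an integral over the fixed interval \<open>{0<..<1}\<close>.\<close>

lemma integral_between_levels:
  fixes \<psi> :: "real \<Rightarrow> real"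
  assumes [measurable]: "\<psi> \<in> borel_measurable borel"
  shows "(LINT s|lborel. \<psi> s * (of_bool (s \<le> c) - of_bool (s \<le> 0))) =
    c * (LINT \<tau>|lborel. \<psi> (c * \<tau>) * indicator {0<..<1} \<tau>)"
proof (cases "c = 0")
  case False
  have ae: "AE \<tau> in lborel. \<tau> \<noteq> (0::real) \<and> \<tau> \<noteq> 1"
    using AE_lborel_singleton[of "0::real"] AE_lborel_singleton[of "1::real"] by eventually_elim simp
  have "(LINT s|lborel. \<psi> s * (of_bool (s \<le> c) - of_bool (s \<le> 0))) =
     \<bar>c\<bar> * (LINT \<tau>|lborel. \<psi> (c * \<tau>) * (of_bool (c * \<tau> \<le> c) - of_bool (c * \<tau> \<le> 0)))"
    using lborel_integral_real_affine[OF False, of "\<lambda>s. \<psi> s * (of_bool (s \<le> c) - of_bool (s \<le> 0))" 0] by simp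
  also have "(LINT \<tau>|lborel. \<psi> (c * \<tau>) * (of_bool (c * \<tau> \<le> c) - of_bool (c * \<tau> \<le> 0))) =
     (LINT \<tau>|lborel. sgn c * (\<psi> (c * \<tau>) * indicator {0<..<1} \<tau>))"
  proof (rule integral_cong_AE)
    show "AE \<tau> in lborel. \<psi> (c * \<tau>) * (of_bool (c * \<tau> \<le> c) - of_bool (c * \<tau> \<le> 0)) =
       sgn c * (\<psi> (c * \<tau>) * indicator {0<..<1} \<tau>)"
      using ae
    proof eventually_elim
      case (elim \<tau>)
      consider "c > 0" | "c < 0" using False by linarith
      then show ?case
      proof cases
        case 1
        then have "c * \<tau> \<le> c \<longleftrightarrow> \<tau> \<le> 1" "c * \<tau> \<le> 0 \<longleftrightarrow> \<tau> \<le> 0"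
          by (simp_all add: mult_le_0_iff)
        then show ?thesis using 1 elim by (auto simp: indicator_def)
      next
        case 2
        then have "c * \<tau> \<le> c \<longleftrightarrow> \<tau> \<ge> 1" "c * \<tau> \<le> 0 \<longleftrightarrow> \<tau> \<ge> 0"
          by (simp_all add: mult_le_0_iff)
        then show ?thesis using 2 elim by (auto simp: indicator_def)
      qed
    qed
  qed measurable
  also have "\<bar>c\<bar> * \<dots> = c * (LINT \<tau>|lborel. \<psi> (c * \<tau>) * indicator {0<..<1} \<tau>)"
    by (simp add: abs_sgn sgn_if)
  finally show ?thesis .
qed simp

text \<open>Tilting the half-space that cuts a facet out of \<open>Q\<close> moves the facet with normal speed
  \<open>v \<bullet> x + c\<close>. Since \<open>v\<close> is orthogonal to the normal \<open>a\<close>, this speed is constant along normal lines, so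
  on each of them the change is the integral over a segment of length proportional to \<open>t\<close>, and dominated
  convergence gives the limit at every point where \<open>indicator Q\<close> is continuous.\<close>

lemma facet_variation_derivative:
  fixes Q :: "'a::euclidean_space set" and f :: "'a \<Rightarrow> real" and b c :: real
  assumes Q: "compact Q" and f: "continuous_on UNIV f" and a: "norm a = 1" and v: "a \<bullet> v = 0"
    and frontier: "AE z in affine_lborel {x. a \<bullet> x = b}. z \<notin> frontier Q"
  shows "((\<lambda>t. LINT x:Q \<inter> {x. a \<bullet> x \<le> b + t * (v \<bullet> x + c)}|lborel. f x) has_real_derivative
    (LINT z|affine_lborel {x. a \<bullet> x = b}. (v \<bullet> z + c) * (indicator Q z * f z))) (at_right 0)"
proof -
  define H where "H = {x. a \<bullet> x = b}"
  define N where "N = affine_lborel H"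
  have [measurable_cong]: "sets N = sets borel" by (simp add: N_def sets_affine_lborel)
  define l where "l x = v \<bullet> x + c" for x
  define \<phi> where "\<phi> x = indicator Q x * f x" for x
  define E where "E t = (LINT x:Q \<inter> {x. a \<bullet> x \<le> b + t * l x}|lborel. f x)" for t
  define G where "G t z = (LINT \<tau>|lborel. \<phi> (z + (t * l z * \<tau>) *\<^sub>R a) * indicator {0<..<1} \<tau>)" for t z
  have aa: "a \<bullet> a = 1" using a by (simp add: dot_square_norm)
  have H: "affine H" "H \<noteq> {}"
  proof -
    show "affine H" unfolding H_def by (rule affine_hyperplane)
    have "b *\<^sub>R a \<in> H" using aa by (simp add: H_def)
    then show "H \<noteq> {}" by blast
  qed
  interpret N: sigma_finite_measure N unfolding N_def by (rule sigma_finite_affine_lborel[OF H])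
  interpret P: pair_sigma_finite N "lborel :: real measure" ..
  have AE_H: "AE z in N. z \<in> H" unfolding N_def by (rule AE_affine_lborel[OF H])
  have [measurable]: "Q \<in> sets borel" using Q by (simp add: borel_compact)
  have [measurable]: "f \<in> borel_measurable borel" using f by (rule borel_measurable_continuous_onI)
  have \<phi>[measurable]: "\<phi> \<in> borel_measurable borel" unfolding \<phi>_def by measurable
  have [measurable]: "l \<in> borel_measurable borel" unfolding l_def by measurable
  obtain C where C: "C \<ge> 0" "\<And>x. \<bar>\<phi> x\<bar> \<le> C"
  proof -
    have "compact (f ` Q)" using Q f by (intro compact_continuous_image) (auto intro: continuous_on_subset)
    then obtain C where C: "\<And>x. x \<in> Q \<Longrightarrow> \<bar>f x\<bar> \<le> C"
      using compact_imp_bounded by (fastforce simp: bounded_iff)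
    have "\<bar>\<phi> x\<bar> \<le> \<bar>C\<bar>" for x using C[of x] by (auto simp: \<phi>_def indicator_def)
    then show ?thesis by (intro that[of "\<bar>C\<bar>"]) auto
  qed
  obtain R0 where R0: "\<And>x. x \<in> Q \<Longrightarrow> norm x \<le> R0"
    using compact_imp_bounded[OF Q] by (auto simp: bounded_iff)
  (* Normal lines that meet Q start from points of the hyperplane in this bounded region, which
     provides an integrable majorant. *)
  define R where "R = 2 * R0 + \<bar>b\<bar>"
  have R: "norm z \<le> R" if "\<phi> (z + s *\<^sub>R a) \<noteq> 0" "z \<in> H" for z s
  proof -
    have n: "norm (z + s *\<^sub>R a) \<le> R0" using that(1) by (intro R0) (auto simp: \<phi>_def indicator_def split: if_splits)
    have "b + s = a \<bullet> (z + s *\<^sub>R a)" using that(2) aa by (simp add: H_def inner_add_right)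
    also have "\<bar>\<dots>\<bar> \<le> R0" using Cauchy_Schwarz_ineq2[of a "z + s *\<^sub>R a"] a n by simp
    finally have "\<bar>s\<bar> \<le> R0 + \<bar>b\<bar>" by linarith
    moreover have "norm z \<le> norm (z + s *\<^sub>R a) + norm (s *\<^sub>R a)"
      using norm_triangle_ineq4[of "z + s *\<^sub>R a" "s *\<^sub>R a"] by simp
    ultimately show ?thesis using n a by (simp add: R_def)
  qed
  have diff: "E t - E 0 = t * (LINT z|N. l z * G t z)" for t
  proof -
    (* The signed indicator of the layer between the old and the new body, times f. *)
    define k where "k x = \<phi> x * (of_bool (a \<bullet> x \<le> b + t * l x) - of_bool (a \<bullet> x \<le> b))" for x
    have [measurable]: "k \<in> borel_measurable borel" unfolding k_def by measurable
    have int: "integrable lborel (\<lambda>x. \<phi> x * of_bool (a \<bullet> x \<le> b + s * l x))" for s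
    proof (rule Bochner_Integration.integrable_bound)
      show "integrable lborel \<phi>"
        using borel_integrable_compact[OF Q continuous_on_subset[OF f]] by (simp add: \<phi>_def[abs_def])
    qed auto
    have Eeq: "E s = (LINT x|lborel. \<phi> x * of_bool (a \<bullet> x \<le> b + s * l x))" for s
      unfolding E_def set_lebesgue_integral_def
      by (intro Bochner_Integration.integral_cong) (auto simp: \<phi>_def indicator_def)
    have "E t - E 0 = (LINT x|lborel. k x)"
      unfolding Eeq k_def using int[of t] int[of 0]
      by (subst Bochner_Integration.integral_diff[symmetric]) (auto simp: right_diff_distrib)
    also have "\<dots> = (LINT x|distr (N \<Otimes>\<^sub>M lborel) borel (\<lambda>(z, s). z + s *\<^sub>R a). k x)"
      unfolding N_def H_def by (simp only: lborel_eq_hyperplane_product[OF a, of b, symmetric])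
    also have "\<dots> = (LINT x|(N \<Otimes>\<^sub>M lborel). k (fst x + snd x *\<^sub>R a))"
      by (subst integral_distr) (auto simp: case_prod_beta)
    also have "\<dots> = (LINT z|N. LINT s|lborel. k (z + s *\<^sub>R a))"
    proof -
      have "integrable lborel k"
        using Bochner_Integration.integrable_diff[OF int[of t] int[of 0]] by (simp add: k_def[abs_def] right_diff_distrib)
      then have "integrable (distr (N \<Otimes>\<^sub>M lborel) borel (\<lambda>(z, s). z + s *\<^sub>R a)) k"
        unfolding N_def H_def by (simp only: lborel_eq_hyperplane_product[OF a, of b, symmetric])
      then have "integrable (N \<Otimes>\<^sub>M lborel) (\<lambda>x. k (fst x + snd x *\<^sub>R a))"
        by (subst (asm) integrable_distr_eq) (auto simp: case_prod_beta)
      then show ?thesis using P.integral_fst'[of "\<lambda>x. k (fst x + snd x *\<^sub>R a)"] by simp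
    qed
    also have "\<dots> = (LINT z|N. t * (l z * G t z))"
    proof (rule integral_cong_AE)
      show "AE z in N. (LINT s|lborel. k (z + s *\<^sub>R a)) = t * (l z * G t z)"
        using AE_H
      proof eventually_elim
        case (elim z)
        have "a \<bullet> z = b" using elim by (simp add: H_def)
        then have "k (z + s *\<^sub>R a) = \<phi> (z + s *\<^sub>R a) * (of_bool (s \<le> t * l z) - of_bool (s \<le> 0))" for s
          using v aa by (simp add: k_def l_def inner_add_right inner_commute[of v a])
        then show ?case
          by (simp add: integral_between_levels G_def)
      qed
    qed (simp_all add: G_def)
    finally show ?thesis by simp
  qed
  have conv: "(\<lambda>i. LINT z|N. l z * G (X i) z) \<longlonglongrightarrow> (LINT z|N. l z * \<phi> z)" if X: "X \<longlonglongrightarrow> 0" for X :: "nat \<Rightarrow> real"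
  proof (rule integral_dominated_convergence)
    define L where "L = norm v * R + \<bar>c\<bar>"
    show "integrable N (\<lambda>z. L * C * indicator (cball 0 R) z)"
      using emeasure_affine_lborel_cball[OF H, of 0 R]
      by (intro integrable_mult_right integrable_real_indicator) (auto simp: N_def sets_affine_lborel)
    show "AE z in N. norm (l z * G (X i) z) \<le> L * C * indicator (cball 0 R) z" for i
      using AE_H
    proof eventually_elim
      case (elim z)
      show ?case
      proof (cases "norm z \<le> R")
        case True
        have "\<bar>v \<bullet> z\<bar> \<le> norm v * R"
          using Cauchy_Schwarz_ineq2[of v z] mult_left_mono[OF True, of "norm v"] by simp
        then have "\<bar>l z\<bar> \<le> L" unfolding l_def L_def by linarith
        moreover have "\<bar>G (X i) z\<bar> \<le> (LINT \<tau>|lborel. C * indicator {0<..<1::real} \<tau>)"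
        proof -
          have "norm (G (X i) z) \<le> (LINT \<tau>|lborel. norm (\<phi> (z + (X i * l z * \<tau>) *\<^sub>R a) * indicator {0<..<1} \<tau>))"
            unfolding G_def by (rule integral_norm_bound)
          also have "\<dots> \<le> (LINT \<tau>|lborel. C * indicator {0<..<1::real} \<tau>)"
          proof (rule integral_mono')
            show "integrable lborel (\<lambda>\<tau>. C * indicator {0<..<1::real} \<tau>)"
              by (intro integrable_mult_right integrable_real_indicator) auto
          qed (use C in \<open>auto simp: indicator_def\<close>)
          finally show ?thesis by simp
        qed
        ultimately have "\<bar>l z\<bar> * \<bar>G (X i) z\<bar> \<le> L * C" by (intro mult_mono) auto
        then show ?thesis using True by (simp add: abs_mult)
      next
        case False
        then have "\<phi> (z + s *\<^sub>R a) = 0" for s using R elim by blast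
        then have "G (X i) z = 0" by (simp add: G_def)
        then show ?thesis using False by simp
      qed
    qed
    show "AE z in N. (\<lambda>i. l z * G (X i) z) \<longlonglongrightarrow> l z * \<phi> z"
      using frontier unfolding H_def[symmetric] N_def[symmetric]
    proof eventually_elim
      case (elim z)
      have cont: "isCont \<phi> z"
        using elim f unfolding \<phi>_def by (auto intro!: continuous_intros isCont_indicator[THEN iffD2] simp: continuous_on_eq_continuous_at)
      have "(\<lambda>i. G (X i) z) \<longlonglongrightarrow> (LINT \<tau>|lborel. \<phi> z * indicator {0<..<1::real} \<tau>)"
        unfolding G_def
      proof (rule integral_dominated_convergence)
        show "integrable lborel (\<lambda>\<tau>. C * indicator {0<..<1::real} \<tau>)"
          by (intro integrable_mult_right integrable_real_indicator) auto
        show "AE \<tau> in lborel. norm (\<phi> (z + (X i * l z * \<tau>) *\<^sub>R a) * indicator {0<..<1} \<tau>) \<le> C * indicator {0<..<1} \<tau>" for i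
          using C by (auto simp: indicator_def)
        have "(\<lambda>i. \<phi> (z + (X i * l z * \<tau>) *\<^sub>R a)) \<longlonglongrightarrow> \<phi> z" for \<tau>
        proof (rule isCont_tendsto_compose[OF cont])
          have "(\<lambda>i. z + (X i * l z * \<tau>) *\<^sub>R a) \<longlonglongrightarrow> z + (0 * l z * \<tau>) *\<^sub>R a"
            by (intro tendsto_intros X)
          then show "(\<lambda>i. z + (X i * l z * \<tau>) *\<^sub>R a) \<longlonglongrightarrow> z" by simp
        qed
        then show "AE \<tau> in lborel. (\<lambda>i. \<phi> (z + (X i * l z * \<tau>) *\<^sub>R a) * indicator {0<..<1} \<tau>) \<longlonglongrightarrow> \<phi> z * indicator {0<..<1} \<tau>"
          by (intro AE_I2 tendsto_mult tendsto_const)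
      qed measurable
      then show ?case by (intro tendsto_mult tendsto_const) simp
    qed
  qed (simp_all add: G_def)
  have "((\<lambda>t. (E t - E 0) / (t - 0)) \<longlongrightarrow> (LINT z|N. l z * \<phi> z)) (at_right 0)"
    unfolding tendsto_at_iff_sequentially comp_def
  proof (intro allI impI)
    fix X :: "nat \<Rightarrow> real" assume X: "\<forall>i. X i \<in> {0<..} - {0}" "X \<longlonglongrightarrow> 0"
    have "(E (X i) - E 0) / (X i - 0) = (LINT z|N. l z * G (X i) z)" for i
      using X(1) by (auto simp: diff dest: spec[of _ i])
    then show "(\<lambda>i. (E (X i) - E 0) / (X i - 0)) \<longlonglongrightarrow> (LINT z|N. l z * \<phi> z)"
      using conv[OF X(2)] by simp
  qed
  then show ?thesis
    by (simp add: has_field_derivative_iff E_def[abs_def] l_def[abs_def] \<phi>_def N_def H_def)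
qed

section \<open>The moment identity on a facet\<close>

text \<open>A facet can be moved freely if \<open>P\<close> is written as a larger convex body \<open>Q\<close> cut by the
  supporting half-space of \<open>F\<close>, with the relative interior of \<open>F\<close> inside \<open>Q\<close>. Dropping from the
  half-spaces that define \<open>P\<close> those with \<open>F\<close> on their boundary achieves this but may lose boundedness, which is
  restored by intersecting with a dilate of \<open>P\<close>.\<close>

lemma facet_constraint_removal:
  fixes P :: "'a::euclidean_space set"
  assumes P: "polytope P" "interior P \<noteq> {}" and F: "F facet_of P"
  obtains a b Q where "norm a = 1" "compact Q" "convex Q" "P = Q \<inter> {x. a \<bullet> x \<le> b}"
    "F = Q \<inter> {x. a \<bullet> x = b}" "affine hull F = {x. a \<bullet> x = b}" "rel_interior F \<subseteq> interior Q"
proof -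
  have Pc: "compact P" "convex P" "polyhedron P"
    using P(1) by (auto simp: polytope_imp_compact polytope_imp_convex polytope_imp_polyhedron)
  have dimP: "aff_dim P = int DIM('a)" using P(2) by (rule aff_dim_nonempty_interior)
  have Ff: "F face_of P" "aff_dim F = int DIM('a) - 1" "F \<noteq> P"
    using F dimP by (auto simp: facet_of_def)
  obtain p where p: "p \<in> interior P" using P(2) by blast
  have pF: "p \<notin> F" using p face_of_disjoint_interior[OF Ff(1,3)] by blast
  have "F exposed_face_of P" using Ff(1) Pc(3) by (simp add: exposed_face_of_polyhedron)
  then obtain a0 b0 where ab0: "P \<subseteq> {x. a0 \<bullet> x \<le> b0}" "F = P \<inter> {x. a0 \<bullet> x = b0}"
    by (auto simp: exposed_face_of_def)
  have Fne: "F \<noteq> {}" using F by (auto simp: facet_of_def)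
  have a0: "a0 \<noteq> 0"
  proof
    assume "a0 = 0"
    then have "b0 = 0" using Fne ab0 by auto
    then show False using \<open>a0 = 0\<close> ab0 Ff(3) by auto
  qed
  define a b where "a = a0 /\<^sub>R norm a0" and "b = b0 / norm a0"
  have a: "norm a = 1" using a0 by (simp add: a_def)
  have scale: "a \<bullet> x \<le> b \<longleftrightarrow> a0 \<bullet> x \<le> b0" "a \<bullet> x = b \<longleftrightarrow> a0 \<bullet> x = b0" for x
    using a0 by (auto simp: a_def b_def divide_simps)
  have PF: "P \<subseteq> {x. a \<bullet> x \<le> b}" "F = P \<inter> {x. a \<bullet> x = b}" using ab0 by (auto simp: scale)
  have pb: "a \<bullet> p < b" using PF p pF interior_subset[of P] by force
  have hull: "affine hull F = {x. c \<bullet> x = d}" if "c \<noteq> 0" "F \<subseteq> {x. c \<bullet> x = d}" for c d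
    using that Ff(2) Fne by (intro affine_dim_equal) (auto simp: affine_hyperplane hull_minimal)
  have hullF: "affine hull F = {x. a \<bullet> x = b}" using a PF by (intro hull) auto
  obtain \<H> where \<H>: "finite \<H>" "P = \<Inter>\<H>" "\<And>h. h \<in> \<H> \<Longrightarrow> \<exists>c d. c \<noteq> 0 \<and> h = {x. c \<bullet> x \<le> d}"
    using Pc(3) unfolding polyhedron_def by auto
  (* The dilate of P by the factor 2 about the interior point p; P lies in its interior. *)
  define Q0 where "Q0 = {x. midpoint p x \<in> P}"
  define \<G> where "\<G> = {h \<in> \<H>. \<not> F \<subseteq> frontier h}"
  define Q where "Q = Q0 \<inter> \<Inter>\<G>"
  have mid: "midpoint p x = (1/2) *\<^sub>R p + (1/2) *\<^sub>R x" for x :: 'a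
    by (simp add: midpoint_def scaleR_add_right)
  have Q0eq: "Q0 = (\<lambda>x. 2 *\<^sub>R x - p) ` P"
  proof (rule set_eqI)
    fix x
    have "x = 2 *\<^sub>R midpoint p x - p" "midpoint p (2 *\<^sub>R y - p) = y" for y
      by (simp_all add: midpoint_def)
    then show "x \<in> Q0 \<longleftrightarrow> x \<in> (\<lambda>x. 2 *\<^sub>R x - p) ` P"
      unfolding Q0_def image_iff mem_Collect_eq by metis
  qed
  have Q0: "compact Q0" "convex Q0"
  proof -
    show "compact Q0" unfolding Q0eq by (intro compact_continuous_image continuous_intros Pc)
    have "convex ((\<lambda>x. x + - p) ` (\<lambda>x. 2 *\<^sub>R x) ` P)"
      using Pc(2) by (simp add: convex_scaling add.commute[of _ "- p"])
    then show "convex Q0" by (simp add: Q0eq image_image)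
  qed
  have pP: "p \<in> P" using p interior_subset by blast
  have PQ0: "P \<subseteq> Q0"
    unfolding Q0_def mid using pP Pc(2) by (auto intro!: convexD)
  have PQ: "P \<subseteq> Q" using PQ0 \<H>(2) by (auto simp: Q_def \<G>_def)
  have cl: "closed h \<and> convex h" if "h \<in> \<H>" for h
    using \<H>(3)[OF that] by (auto simp: closed_halfspace_le convex_halfspace_le)
  show ?thesis
  proof (rule that[OF a])
    show "compact Q" unfolding Q_def
      using Q0(1) cl by (intro compact_Int_closed closed_Inter) (auto simp: \<G>_def)
    show "convex Q" unfolding Q_def
      using Q0(2) cl by (intro convex_Int convex_Inter) (auto simp: \<G>_def)
    show PQb: "P = Q \<inter> {x. a \<bullet> x \<le> b}"
    proof
      show "Q \<inter> {x. a \<bullet> x \<le> b} \<subseteq> P"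
      proof
        fix x assume x: "x \<in> Q \<inter> {x. a \<bullet> x \<le> b}"
        have "x \<in> h" if h: "h \<in> \<H>" for h
        proof (cases "h \<in> \<G>")
          case True
          then show ?thesis using x by (auto simp: Q_def)
        next
          case False
          obtain c d where cd: "c \<noteq> 0" "h = {x. c \<bullet> x \<le> d}" using \<H>(3)[OF h] by blast
          have "F \<subseteq> {x. c \<bullet> x = d}" using False h cd by (auto simp: \<G>_def frontier_halfspace_le)
          then have eq: "{x. c \<bullet> x = d} = {x. a \<bullet> x = b}" using hull[OF cd(1)] hullF by simp
          have "p \<in> h" using pP \<H>(2) h by auto
          moreover have "c \<bullet> p \<noteq> d" using eq pb by auto
          ultimately have cp: "c \<bullet> p < d" using cd by auto
          show ?thesis
          proof (rule ccontr)
            assume "x \<notin> h"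
            then have cx: "c \<bullet> x > d" using cd by auto
            (* The segment from p to x leaves h at this parameter, hence crosses the hyperplane of F
               before its end, although both p and x lie on the same side of it and p does so strictly. *)
            define \<theta> where "\<theta> = (d - c \<bullet> p) / (c \<bullet> x - c \<bullet> p)"
            have \<theta>: "0 < \<theta>" "\<theta> < 1" using cp cx by (auto simp: \<theta>_def field_simps)
            have "\<theta> * (c \<bullet> x - c \<bullet> p) = d - c \<bullet> p" using cp cx by (simp add: \<theta>_def)
            then have "c \<bullet> (p + \<theta> *\<^sub>R (x - p)) = d" by (simp add: inner_add_right inner_diff_right)
            then have "a \<bullet> (p + \<theta> *\<^sub>R (x - p)) = b" using eq by blast
            then have "(1 - \<theta>) * (b - a \<bullet> p) + \<theta> * (b - a \<bullet> x) = 0"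
              by (simp add: inner_add_right inner_diff_right algebra_simps)
            moreover have "(1 - \<theta>) * (b - a \<bullet> p) > 0" using \<theta> pb by simp
            moreover have "\<theta> * (b - a \<bullet> x) \<ge> 0" using \<theta> x by simp
            ultimately show False by linarith
          qed
        qed
        then show "x \<in> P" using \<H>(2) by auto
      qed
    qed (use PQ PF in auto)
    show "F = Q \<inter> {x. a \<bullet> x = b}" using PF(2) PQb by auto
    show "affine hull F = {x. a \<bullet> x = b}" by (rule hullF)
    show "rel_interior F \<subseteq> interior Q"
    proof
      fix x assume x: "x \<in> rel_interior F"
      then have xP: "x \<in> P" using rel_interior_subset PF(2) by blast
      have "x \<in> interior Q0"
      proof -
        have "midpoint p x \<in> interior P"
        proof -
          have "x = (1/2) *\<^sub>R x + (1/2) *\<^sub>R x"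
            using scaleR_half_double[of x] by (simp only: scaleR_add_right)
          then have "x - (1/2) *\<^sub>R (x - p) = midpoint p x"
            by (simp add: mid scaleR_diff_right) (metis add.commute add_diff_cancel_right' diff_add_eq diff_diff_eq2)
          then show ?thesis
            using mem_interior_convex_shrink[OF Pc(2) p xP, of "1/2"] by simp
        qed
        moreover have "open {x. midpoint p x \<in> interior P}"
          using open_vimage[OF open_interior, of "midpoint p" P]
          unfolding mid vimage_def by (simp add: continuous_intros)
        moreover have "{x. midpoint p x \<in> interior P} \<subseteq> Q0" using interior_subset by (auto simp: Q0_def)
        ultimately show ?thesis using interior_maximal by blast
      qed
      moreover have "x \<in> interior h" if h: "h \<in> \<G>" for h
      proof -
        have h\<H>: "h \<in> \<H>" using h by (auto simp: \<G>_def)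
        obtain c d where cd: "c \<noteq> 0" "h = {x. c \<bullet> x \<le> d}" using \<H>(3)[OF h\<H>] by blast
        have Pcd: "\<And>x. x \<in> P \<Longrightarrow> c \<bullet> x \<le> d" using cd \<H>(2) h\<H> by auto
        have "c \<bullet> x \<noteq> d"
        proof
          assume "c \<bullet> x = d"
          moreover have "P \<inter> {x. c \<bullet> x = d} face_of P"
            using Pcd Pc(2) by (intro face_of_Int_supporting_hyperplane_le) auto
          ultimately have "F \<subseteq> P \<inter> {x. c \<bullet> x = d}"
            using x xP PF(2) by (intro subset_of_face_of[of "P \<inter> {x. c \<bullet> x = d}" P F]) auto
          then show False using h cd by (auto simp: \<G>_def frontier_halfspace_le)
        qed
        then have "c \<bullet> x < d" using Pcd[OF xP] by simp
        then show ?thesis using cd by (simp add: interior_halfspace_le)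
      qed
      ultimately have "x \<in> interior Q0 \<inter> \<Inter>(interior ` \<G>)" by blast
      moreover have "open (interior Q0 \<inter> \<Inter>(interior ` \<G>))"
        using \<H>(1) by (intro open_Int open_Inter) (auto simp: \<G>_def)
      moreover have "interior Q0 \<inter> \<Inter>(interior ` \<G>) \<subseteq> Q"
        using interior_subset by (fastforce simp: Q_def)
      ultimately show "x \<in> interior Q" using interior_maximal by blast
    qed
  qed
qed

text \<open>On the hyperplane of \<open>F\<close> every linear function agrees with some \<open>v \<bullet> x + c\<close> where \<open>v\<close>
  is orthogonal to the normal. Moving the facet with this speed and with the opposite one gives two opposite
  first-order inequalities.\<close>

lemma facet_moment_identity:
  fixes P :: "(real ^ 'n) set" and w :: "real ^ 'n"
  assumes P: "polytope P" and iso: "isotropic P" and max: "isotropic_constant_local_maximizer P"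
    and F: "F facet_of P"
  shows "(LINT x|vol_face F. (w \<bullet> x) * ((norm x)\<^sup>2 - real CARD('n) - 2)) = 0"
proof -
  define g where "g x = (norm x)\<^sup>2 - real CARD('n) - 2" for x :: "real ^ 'n"
  have gc: "continuous_on UNIV g" unfolding g_def by (intro continuous_intros)
  have gm[measurable]: "g \<in> borel_measurable borel" by (rule borel_measurable_continuous_onI[OF gc])
  have Pb: "full_dim_convex_body P" using max by (simp add: isotropic_constant_local_maximizer_def)
  note Pc = full_dim_convex_bodyD[OF Pb]
  obtain a b Q where Q: "norm a = 1" "compact Q" "convex Q" "P = Q \<inter> {x. a \<bullet> x \<le> b}"
    "F = Q \<inter> {x. a \<bullet> x = b}" "affine hull F = {x. a \<bullet> x = b}" "rel_interior F \<subseteq> interior Q"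
    by (rule facet_constraint_removal[OF P Pc(3) F])
  have aa: "a \<bullet> a = 1" using Q(1) by (simp add: dot_square_norm)
  define N where "N = affine_lborel {x. a \<bullet> x = b}"
  have H: "affine {x. a \<bullet> x = b}" "{x. a \<bullet> x = b} \<noteq> {}"
  proof -
    have "b *\<^sub>R a \<in> {x. a \<bullet> x = b}" using aa by simp
    then show "{x. a \<bullet> x = b} \<noteq> {}" by blast
  qed (rule affine_hyperplane)
  have [measurable_cong]: "sets N = sets borel" by (simp add: N_def sets_affine_lborel)
  have AE_H: "AE z in N. a \<bullet> z = b" using AE_affine_lborel[OF H] by (simp only: N_def mem_Collect_eq)
  have [measurable]: "Q \<in> sets borel" using Q(2) by (simp add: borel_compact)
  have Fc: "convex F" "closed F"
    using Q by (auto intro!: convex_Int convex_hyperplane closed_Int closed_hyperplane compact_imp_closed)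
  then have [measurable]: "F \<in> sets borel" by (simp add: borel_closed)
  have FH: "F \<subseteq> {x. a \<bullet> x = b}" using Q(5) by blast
  have frontier: "AE z in affine_lborel {x. a \<bullet> x = b}. z \<notin> frontier Q"
    using AE_rel_interior_in_hyperplane[OF Fc(1) FH Q(1)] AE_affine_lborel[OF H]
  proof eventually_elim
    case (elim z)
    have "z \<in> Q \<Longrightarrow> z \<in> interior Q" using elim Q(5,7) by auto
    then show ?case using compact_imp_closed[OF Q(2)] by (auto simp: frontier_def)
  qed
  have face: "(LINT z|N. l z * (indicator Q z * g z)) = (LINT z|vol_face F. l z * g z)"
    if [measurable]: "l \<in> borel_measurable borel" for l
  proof -
    have "(LINT z|vol_face F. l z * g z) = (LINT z|N. indicator F z *\<^sub>R (l z * g z))"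
      unfolding vol_face_def Q(6) N_def[symmetric]
      by (subst integral_density[symmetric]) (auto simp: ennreal_indicator)
    also have "\<dots> = (LINT z|N. l z * (indicator Q z * g z))"
      using AE_H by (intro integral_cong_AE) (auto simp: Q(5) indicator_def)
    finally show ?thesis ..
  qed
  have le: "(LINT z|vol_face F. (v \<bullet> z + c) * g z) \<le> 0" if v: "a \<bullet> v = 0" for v c
  proof -
    define K where "K t = Q \<inter> {x. a \<bullet> x \<le> b + t * (v \<bullet> x + c)}" for t
    have "(LINT z|N. (v \<bullet> z + c) * (indicator Q z * g z)) \<le> 0"
      unfolding g_def
    proof (rule local_maximizer_first_order[OF iso max, of K "\<lambda>f. (LINT z|N. (v \<bullet> z + c) * (indicator Q z * f z))"])
      show "K 0 = P" by (simp add: K_def Q(4))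
      show "((\<lambda>t. LINT x:K t|lborel. f x) has_real_derivative
          (LINT z|N. (v \<bullet> z + c) * (indicator Q z * f z))) (at_right 0)"
        if "continuous_on UNIV f" for f :: "real ^ 'n \<Rightarrow> real"
        unfolding K_def N_def by (rule facet_variation_derivative[OF Q(2) that Q(1) v frontier])
      obtain p where p: "p \<in> interior P" using Pc(3) by blast
      have pint: "p \<in> interior Q" "a \<bullet> p < b"
      proof -
        have ane: "a \<noteq> 0" using Q(1) by auto
        have "p \<in> interior Q \<inter> interior {x. a \<bullet> x \<le> b}" using p unfolding Q(4) by simp
        then show "p \<in> interior Q" "a \<bullet> p < b" using ane by (auto simp: interior_halfspace_le)
      qed
      have "((\<lambda>t. b + t * (v \<bullet> p + c)) \<longlongrightarrow> b + 0 * (v \<bullet> p + c)) (at_right 0)"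
        by (intro tendsto_intros)
      then have "\<forall>\<^sub>F t in at_right 0. a \<bullet> p < b + t * (v \<bullet> p + c)"
        using order_tendstoD(1)[of _ "b + 0 * (v \<bullet> p + c)"] pint(2) by simp
      then show "\<forall>\<^sub>F t in at_right 0. full_dim_convex_body (K t)"
      proof eventually_elim
        case (elim t)
        have eq: "K t = Q \<inter> {x. (a - t *\<^sub>R v) \<bullet> x \<le> b + t * c}"
          by (auto simp: K_def algebra_simps inner_diff_left inner_add_left)
        have "open (interior Q \<inter> {x. (a - t *\<^sub>R v) \<bullet> x < b + t * c})"
          by (intro open_Int open_interior open_halfspace_lt)
        moreover have "p \<in> interior Q \<inter> {x. (a - t *\<^sub>R v) \<bullet> x < b + t * c}"
          using pint(1) elim by (simp add: inner_diff_left algebra_simps)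
        moreover have "interior Q \<inter> {x. (a - t *\<^sub>R v) \<bullet> x < b + t * c} \<subseteq> K t"
          using interior_subset[of Q] by (auto simp: eq)
        ultimately have "p \<in> interior (K t)" using interior_maximal by blast
        then have "interior (K t) \<noteq> {}" by blast
        moreover from this have "K t \<noteq> {}" using interior_subset by blast
        moreover have "compact (K t)" "convex (K t)"
          unfolding eq using Q(2,3)
          by (auto intro!: compact_Int_closed closed_halfspace_le convex_Int convex_halfspace_le)
        ultimately show ?case
          using aff_dim_nonempty_interior[of "K t"] by (simp add: full_dim_convex_body_def convex_body_def)
      qed
    qed
    also have "(LINT z|N. (v \<bullet> z + c) * (indicator Q z * g z)) = (LINT z|vol_face F. (v \<bullet> z + c) * g z)"
      by (rule face) measurable
    finally show ?thesis .
  qed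
  define v c where "v = w - (w \<bullet> a) *\<^sub>R a" and "c = (w \<bullet> a) * b"
  have v: "a \<bullet> v = 0" "a \<bullet> (- v) = 0" using aa by (simp_all add: v_def inner_diff_right inner_commute)
  have "AE z in vol_face F. a \<bullet> z = b"
    unfolding vol_face_def Q(6) N_def[symmetric] using AE_H by (subst AE_density) auto
  then have w: "AE z in vol_face F. w \<bullet> z = v \<bullet> z + c"
    by eventually_elim (simp add: v_def c_def inner_diff_left)
  have "(LINT z|vol_face F. (v \<bullet> z + c) * g z) = 0"
  proof (rule antisym)
    have "(LINT z|vol_face F. ((- v) \<bullet> z + (- c)) * g z) = - (LINT z|vol_face F. (v \<bullet> z + c) * g z)"
      unfolding integral_minus[symmetric] by (intro Bochner_Integration.integral_cong) (auto simp: algebra_simps)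
    then show "0 \<le> (LINT z|vol_face F. (v \<bullet> z + c) * g z)" using le[OF v(2), of "- c"] by simp
  qed (rule le[OF v(1)])
  moreover have "(LINT z|vol_face F. (w \<bullet> z) * g z) = (LINT z|vol_face F. (v \<bullet> z + c) * g z)"
    using w by (intro integral_cong_AE) auto
  ultimately show ?thesis by (simp add: g_def)
qed

lemma facet_expectation_identity:
  fixes P :: "(real ^ 'n) set" and M :: "'w measure" and X :: "'w \<Rightarrow> real ^ 'n"
  assumes P: "polytope P" and iso: "isotropic P" and max: "isotropic_constant_local_maximizer P"
    and F: "F facet_of P" and M: "prob_space M" and X: "X \<in> borel_measurable M"
    and distr: "distr M borel X = uniform_measure (vol_face F) F"
  shows "prob_space.expectation M (\<lambda>\<omega>. (norm (X \<omega>))\<^sup>2 *\<^sub>R X \<omega>)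
    = (real CARD('n) + 2) *\<^sub>R prob_space.expectation M X"
proof -
  define n where "n = real CARD('n)"
  have Fc: "compact F" "F \<noteq> {}"
    using F P face_of_polytope_polytope[OF P] polytope_imp_compact by (auto simp: facet_of_def)
  interpret finite_measure "vol_face F" by (rule finite_measure_vol_face[OF Fc])
  have [measurable]: "F \<in> sets borel" using Fc by (simp add: borel_compact)
  have AE_F: "AE x in vol_face F. x \<in> F"
    unfolding vol_face_def
    by (subst AE_density) (auto simp: sets_affine_lborel indicator_def intro!: AE_I2)
  have int: "integrable (vol_face F) f" if f: "continuous_on UNIV f" for f :: "real ^ 'n \<Rightarrow> real ^ 'n"
  proof -
    have [measurable]: "f \<in> borel_measurable borel" by (rule borel_measurable_continuous_onI[OF f])
    have "compact (f ` F)" using Fc f by (intro compact_continuous_image) (auto intro: continuous_on_subset)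
    then obtain C where "\<And>x. x \<in> F \<Longrightarrow> norm (f x) \<le> C"
      using compact_imp_bounded by (fastforce simp: bounded_iff)
    then have "AE x in vol_face F. norm (f x) \<le> C" using AE_F by (auto elim: eventually_mono)
    then show ?thesis by (rule integrable_const_bound) auto
  qed
  define m where "m = measure (vol_face F) F"
  have m: "emeasure (vol_face F) F = ennreal m" by (simp add: m_def emeasure_eq_measure)
  have "m \<noteq> 0"
  proof
    assume "m = 0"
    have "emeasure (uniform_measure (vol_face F) F) UNIV = 1"
      using prob_space.emeasure_space_1[OF prob_space.prob_space_distr[OF M X]] distr by simp
    moreover have "emeasure (uniform_measure (vol_face F) F) UNIV = emeasure (vol_face F) F / emeasure (vol_face F) F"
      by (subst emeasure_uniform_measure) (auto simp: sets_vol_face)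
    ultimately show False using \<open>m = 0\<close> by (simp add: m)
  qed
  then have m0: "m > 0" by (simp add: m_def zero_less_measure_iff)
  have uni: "uniform_measure (vol_face F) F = density (vol_face F) (\<lambda>x. ennreal (indicator F x / m))"
    unfolding uniform_measure_def m using m0
    by (intro density_cong) (auto simp: indicator_def divide_ennreal ennreal_1[symmetric] simp del: ennreal_1)
  have E: "prob_space.expectation M (\<lambda>\<omega>. f (X \<omega>)) = (1 / m) *\<^sub>R (LINT x|vol_face F. f x)"
    if [measurable]: "f \<in> borel_measurable borel" for f :: "real ^ 'n \<Rightarrow> real ^ 'n"
  proof -
    have "prob_space.expectation M (\<lambda>\<omega>. f (X \<omega>)) = (LINT x|distr M borel X. f x)"
      using X by (subst integral_distr) auto
    also have "\<dots> = (LINT x|vol_face F. (indicator F x / m) *\<^sub>R f x)"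
      unfolding distr uni using m0 by (intro integral_density) auto
    also have "\<dots> = (LINT x|vol_face F. (1 / m) *\<^sub>R f x)"
    proof (rule integral_cong_AE)
      show "AE x in vol_face F. (indicator F x / m) *\<^sub>R f x = (1 / m) *\<^sub>R f x"
        using AE_F by eventually_elim simp
    qed measurable
    finally show ?thesis by simp
  qed
  have c1: "continuous_on UNIV (\<lambda>x :: real ^ 'n. (norm x)\<^sup>2 *\<^sub>R x)" "continuous_on UNIV (\<lambda>x :: real ^ 'n. x)"
    by (intro continuous_intros)+
  have "(LINT x|vol_face F. (norm x)\<^sup>2 *\<^sub>R x) - (n + 2) *\<^sub>R (LINT x|vol_face F. x)
    = (LINT x|vol_face F. (norm x)\<^sup>2 *\<^sub>R x - (n + 2) *\<^sub>R x)"
    using int[OF c1(1)] int[OF c1(2)] by simp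
  also have "\<dots> = 0"
  proof (rule vector_eq_ldot[THEN iffD1], rule allI)
    fix w :: "real ^ 'n"
    have "w \<bullet> (LINT x|vol_face F. (norm x)\<^sup>2 *\<^sub>R x - (n + 2) *\<^sub>R x) =
      (LINT x|vol_face F. w \<bullet> ((norm x)\<^sup>2 *\<^sub>R x - (n + 2) *\<^sub>R x))"
      using int[OF c1(1)] int[OF c1(2)] by (intro integral_inner_right[symmetric]) auto
    also have "\<dots> = (LINT x|vol_face F. (w \<bullet> x) * ((norm x)\<^sup>2 - real CARD('n) - 2))"
      by (simp add: n_def inner_diff_right algebra_simps)
    also have "\<dots> = 0" by (rule facet_moment_identity[OF P iso max F])
    finally show "w \<bullet> (LINT x|vol_face F. (norm x)\<^sup>2 *\<^sub>R x - (n + 2) *\<^sub>R x) = w \<bullet> 0" by simp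
  qed
  finally show ?thesis
    using E[OF borel_measurable_continuous_onI[OF c1(1)]] E[OF borel_measurable_continuous_onI[OF c1(2)]]
    by (simp add: n_def algebra_simps)
qed

theorem corollary7p3:
  fixes P :: "(real ^ 'n) set"
  assumes "polytope P"
    and "aff_dim P = int CARD('n)"
    and "isotropic P"
    and "isotropic_constant_local_maximizer P"
  shows "metric_projection (vol_faces P) (W2 P)
           (ae_class (vol_faces P) (\<lambda>x. (norm x)\<^sup>2 - real CARD('n) - 2))
         = ae_class (vol_faces P) (\<lambda>x. 0)
    \<and> (\<forall>F (M :: 'w measure) (X :: 'w \<Rightarrow> real ^ 'n).
          F facet_of P \<and> prob_space M \<and> X \<in> borel_measurable M \<and>
          distr M borel X = uniform_measure (vol_face F) F \<longrightarrow>
          prob_space.expectation M (\<lambda>\<omega>. (norm (X \<omega>))\<^sup>2 *\<^sub>R X \<omega>)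
          = (real CARD('n) + 2) *\<^sub>R prob_space.expectation M X)"
  using metric_projection_W2_eq_zero[OF assms(1,3,4)] facet_expectation_identity[OF assms(1,3,4)] by blast

end
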